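(* (i) For every homothetic pair there is a one-parameter family of pairwise distinct Brocard porisms such that, for each Brocard porism in this family, the family of 3-periodics of the homothetic pair and the family of 3-periodics of the Brocard porism are images of one another under a variable similarity transform. (ii) Conversely, for every Brocard porism there is a one-parameter family of pairwise distinct homothetic pairs such that, for each homothetic pair in this family, the family of 3-periodics of the Brocard porism and the family of 3-periodics of the homothetic pair are images of one another under a variable similarity transform.
   Context: A homothetic pair consists of an ellipse with semi-axes $a,b>0$ and the concentric, axis-aligned ellipse with semi-axes $a/2,b/2$. Its 3-periodics are the triangles inscribed in the outer ellipse (vertices on it) and circumscribed about the inner ellipse (sides tangent to it). The Brocard inellipse of a triangle is the ellipse tangent to its three sides at the feet of its symmedians, i.e. at the points where the cevians through the symmedian point $X_6$ meet the opposite sides; its foci are the two Brocard points of the triangle. A Brocard porism is a pair consisting of a circle and an ellipse which are the circumcircle and the Brocard inellipse of some triangle; its 3-periodics are the triangles inscribed in that circle and circumscribed about that ellipse (a one-parameter Poncelet family). Two families of triangles are images of one another under a variable similarity transform if every triangle of either family is mapped onto some triangle of the other by a similarity of the plane (a composition of isometries and a scaling), where the similarity is allowed to depend on the triangle. *)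

theory Defs
  imports "HOL-Analysis.Analysis"
begin

text \<open>The Euclidean plane is the type \<^typ>\<open>complex\<close>. Curves are point sets, and a triangle is
  the set of its three vertices.\<close>

type_synonym curve_pair = "complex set \<times> complex set"

definition triangle :: "complex set \<Rightarrow> bool" where
  "triangle T \<longleftrightarrow> card T = 3 \<and> \<not> collinear T"

text \<open>Centre \<open>c\<close>, semi-axes \<open>a\<close> and \<open>b\<close>, the \<open>a\<close>-axis making the angle \<open>\<theta>\<close> with the real axis.\<close>

definition ellipse :: "complex \<Rightarrow> real \<Rightarrow> real \<Rightarrow> real \<Rightarrow> complex set" where
  "ellipse c \<theta> a b = {c + cis \<theta> * Complex x y | x y. (x / a)\<^sup>2 + (y / b)\<^sup>2 = 1}"

text \<open>A line is tangent to an ellipse at \<open>P\<close> iff \<open>P\<close> is their only common point. The point of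
  contact is moreover required to lie on the side itself, not merely on its extension.\<close>

definition side_tangent_at :: "complex \<Rightarrow> complex \<Rightarrow> complex \<Rightarrow> complex set \<Rightarrow> bool" where
  "side_tangent_at A B P E \<longleftrightarrow> P \<in> closed_segment A B \<and> affine hull {A, B} \<inter> E = {P}"

text \<open>The triangles inscribed in the first curve and circumscribed about the second.\<close>

definition three_periodics :: "curve_pair \<Rightarrow> complex set set" where
  "three_periodics P = {T. triangle T \<and> T \<subseteq> fst P \<and>
     (\<forall>A\<in>T. \<forall>B\<in>T. A \<noteq> B \<longrightarrow> (\<exists>D. side_tangent_at A B D (snd P)))}"

definition homothetic_pair :: "curve_pair \<Rightarrow> bool" where
  "homothetic_pair P \<longleftrightarrow>
     (\<exists>c \<theta> a b. 0 < a \<and> 0 < b \<and> P = (ellipse c \<theta> a b, ellipse c \<theta> (a / 2) (b / 2)))"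

text \<open>Reflection of \<open>X\<close> in the line through \<open>A\<close> with direction \<open>u \<noteq> 0\<close>.\<close>

definition reflect_line :: "complex \<Rightarrow> complex \<Rightarrow> complex \<Rightarrow> complex" where
  "reflect_line A u X = A + (2 * ((X - A) \<bullet> u) / (u \<bullet> u)) *\<^sub>R u - (X - A)"

text \<open>The symmedian from \<open>A\<close> is the mirror image of the median from \<open>A\<close> in the bisector of the
  angle at \<open>A\<close>, which has direction \<open>sgn (B - A) + sgn (C - A)\<close>. The three symmedians of a triangle
  are its cevians through the symmedian point.\<close>

definition symmedian :: "complex \<Rightarrow> complex \<Rightarrow> complex \<Rightarrow> complex set" where
  "symmedian A B C =
     affine hull {A, reflect_line A (sgn (B - A) + sgn (C - A)) (midpoint B C)}"

definition brocard_inellipse :: "complex \<Rightarrow> complex \<Rightarrow> complex \<Rightarrow> complex set \<Rightarrow> bool" where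
  "brocard_inellipse A B C E \<longleftrightarrow>
     (\<exists>c \<theta> a b. 0 < a \<and> 0 < b \<and> E = ellipse c \<theta> a b) \<and>
     (\<exists>D \<in> symmedian A B C. side_tangent_at B C D E) \<and>
     (\<exists>D \<in> symmedian B C A. side_tangent_at C A D E) \<and>
     (\<exists>D \<in> symmedian C A B. side_tangent_at A B D E)"

definition brocard_porism :: "curve_pair \<Rightarrow> bool" where
  "brocard_porism P \<longleftrightarrow>
     (\<exists>A B C z R. triangle {A, B, C} \<and> 0 < R \<and> fst P = sphere z R \<and> {A, B, C} \<subseteq> sphere z R \<and>
        brocard_inellipse A B C (snd P))"

definition plane_isometry :: "(complex \<Rightarrow> complex) \<Rightarrow> bool" where
  "plane_isometry f \<longleftrightarrow> (\<forall>x y. dist (f x) (f y) = dist x y)"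

definition similarity :: "(complex \<Rightarrow> complex) \<Rightarrow> bool" where
  "similarity f \<longleftrightarrow>
     (\<exists>g h r. plane_isometry g \<and> plane_isometry h \<and> 0 < r \<and> f = g \<circ> (\<lambda>z. r *\<^sub>R z) \<circ> h)"

definition variable_similarity_images :: "complex set set \<Rightarrow> complex set set \<Rightarrow> bool" where
  "variable_similarity_images \<F> \<G> \<longleftrightarrow>
     (\<forall>T\<in>\<F>. \<exists>f. similarity f \<and> f ` T \<in> \<G>) \<and> (\<forall>T\<in>\<G>. \<exists>f. similarity f \<and> f ` T \<in> \<F>)"

text \<open>A family of ellipses, parametrised by \<open>I\<close>, whose centre, inclination and semi-axes can be
  chosen to depend continuously on the parameter. Circles are the case of equal semi-axes.\<close>

definition continuous_ellipses :: "real set \<Rightarrow> (real \<Rightarrow> complex set) \<Rightarrow> bool" where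
  "continuous_ellipses I E \<longleftrightarrow>
     (\<exists>c \<theta> a b. continuous_on I c \<and> continuous_on I \<theta> \<and> continuous_on I a \<and> continuous_on I b \<and>
        (\<forall>t\<in>I. 0 < a t \<and> 0 < b t \<and> E t = ellipse (c t) (\<theta> t) (a t) (b t)))"

definition one_parameter_family :: "real set \<Rightarrow> (real \<Rightarrow> curve_pair) \<Rightarrow> bool" where
  "one_parameter_family I F \<longleftrightarrow> open I \<and> is_interval I \<and> I \<noteq> {} \<and>
     continuous_ellipses I (\<lambda>t. fst (F t)) \<and> continuous_ellipses I (\<lambda>t. snd (F t))"

end

theory Submission
  imports Defs
begin

text \<open>Write the vertices of a triangle as \<open>p + \<alpha> + \<beta>\<close>, \<open>p + \<alpha> \<omega> + \<beta> \<omega>\<^sup>2\<close>, \<open>p + \<alpha> \<omega>\<^sup>2 + \<beta> \<omega>\<close> with a primitive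
cube root of unity \<open>\<omega>\<close>. The quotient \<open>\<beta> / \<alpha>\<close> determines the triangle up to an orientation-preserving
similarity, and its modulus (taken below 1 by the choice of the labelling) encodes the Brocard angle.
Both Poncelet families of the theorem turn out to consist of triangles for which \<open>\<beta> / \<alpha>\<close> runs through
a full circle \<open>\<bar>\<beta> / \<alpha>\<bar> = r\<close>. Hence a homothetic pair and a Brocard porism with the same \<open>r\<close> have the
same triangles up to similarity (\<open>all_shapes_similarity_images\<close>), and scaling one of the two
pairs gives a one-parameter family with the same \<open>r\<close>.

The circles are found by transporting one model case. The triangles inscribed in the unit circle and
circumscribed about the circle of radius \<open>1/2\<close> are the equilateral ones
(\<open>concentric_three_periodics\<close>). Incidence, and tangency in the sense of a single common point, are
preserved by any injective map of the closed disc that maps segments onto segments, so the image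
pair of circles has the images of the equilateral triangles as its triangles
(\<open>collineation_three_periodics\<close>). Two kinds of such maps are used.

An affine map \<open>z \<mapsto> c + \<alpha> z + \<beta> \<cdot> cnj z\<close> produces a homothetic pair. It sends \<open>u, u \<omega>, u \<omega>\<^sup>2\<close> to a triangle
with quotient \<open>(\<beta> / \<alpha>) (cnj u)\<^sup>2\<close>, and \<open>r = \<bar>a - b\<bar> / (a + b)\<close> for semi-axes \<open>a\<close>, \<open>b\<close>.

A hyperbolic translation of the disc in the Klein model, followed by a similarity, produces a Brocard
porism. It preserves the unit circle, on which it acts as the Moebius map \<open>z \<mapsto> (z + s) / (1 + s z)\<close>,
and a geometric series gives the quotient \<open>- s u\<close> for the image of \<open>u, u \<omega>, u \<omega>\<^sup>2\<close>; so \<open>r = s\<close>. The image of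
the incircle touches the sides of the image triangle at the images of the midpoints, and these are
the feet of the symmedians (\<open>brocard_map_symmedian_foot\<close>), so that it is the Brocard inellipse.
Conversely every triangle has a quotient \<open>- s u\<close> after relabelling, hence is such an image
(\<open>triangle_is_brocard_image\<close>); since an ellipse is determined by its points of contact with the
three sides (\<open>brocard_inellipse_unique\<close>), every Brocard porism arises in this way.\<close>

section \<open>Poncelet triangles between concentric circles\<close>

definition \<omega> :: complex where "\<omega> = Complex (-1/2) (sqrt 3 / 2)"

lemma omega_facts: "norm \<omega> = 1" "\<omega>\<^sup>2 = cnj \<omega>" "\<omega> ^ 3 = 1" "1 + \<omega> + \<omega>\<^sup>2 = 0" "\<omega> \<noteq> 1" "\<omega>\<^sup>2 \<noteq> 1" "\<omega>\<^sup>2 \<noteq> \<omega>"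
proof -
  have n: "(norm \<omega>)\<^sup>2 = 1"
    by (simp add: \<omega>_def cmod_power2 power_divide)
  then show "norm \<omega> = 1"
    by (simp add: power2_eq_1_iff) (smt (verit) norm_ge_zero)
  show sq: "\<omega>\<^sup>2 = cnj \<omega>"
    by (simp add: \<omega>_def complex_eq_iff power2_eq_square)
  show "\<omega> ^ 3 = 1"
  proof -
    have "\<omega> ^ 3 = \<omega> * \<omega>\<^sup>2" by (simp add: power3_eq_cube power2_eq_square)
    also have "\<dots> = complex_of_real ((norm \<omega>)\<^sup>2)"
      by (simp only: sq complex_norm_square)
    finally show ?thesis using n by simp
  qed
  show "1 + \<omega> + \<omega>\<^sup>2 = 0" "\<omega> \<noteq> 1" "\<omega>\<^sup>2 \<noteq> 1" "\<omega>\<^sup>2 \<noteq> \<omega>"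
    unfolding sq by (simp_all add: \<omega>_def complex_eq_iff)
qed

lemma affine_hull_2_eq: "affine hull {A, B :: complex} = {(1 - t) *\<^sub>R A + t *\<^sub>R B | t. True}"
  unfolding affine_hull_2 by auto (metis add.commute add_diff_cancel_right' diff_add_cancel)+

text \<open>Otherwise reflecting the common point in the perpendicular from the
centre would give a second one.\<close>

lemma tangent_line_orthogonal:
  fixes P Q D :: complex
  assumes "P \<noteq> Q" and touch: "affine hull {P, Q} \<inter> sphere 0 r = {D}"
  shows "D \<bullet> (Q - P) = 0" and "norm D = r"
proof -
  define v where "v = Q - P"
  have v: "v \<bullet> v \<noteq> 0" using assms(1) by (simp add: v_def)
  from touch have D: "D \<in> affine hull {P, Q}" "norm D = r" by auto
  then show "norm D = r" by simp
  from D obtain t where t: "D = P + t *\<^sub>R v"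
    by (auto simp: affine_hull_2_eq v_def algebra_simps)
  \<comment> \<open>The mirror image of \<open>D\<close> in the perpendicular from the centre lies on the line and the circle.\<close>
  define k where "k = - 2 * (D \<bullet> v) / (v \<bullet> v)"
  define D' where "D' = D + k *\<^sub>R v"
  have "D' = (1 - (t + k)) *\<^sub>R P + (t + k) *\<^sub>R Q"
    by (simp add: D'_def t v_def algebra_simps)
  then have 1: "D' \<in> affine hull {P, Q}" unfolding affine_hull_2_eq by blast
  have "D' \<bullet> D' = D \<bullet> D + k * (2 * (D \<bullet> v) + k * (v \<bullet> v))"
    by (simp add: D'_def inner_add_left inner_add_right inner_commute[of v D] distrib_left)
  also have "2 * (D \<bullet> v) + k * (v \<bullet> v) = 0" using v by (simp add: k_def)
  finally have "norm D' = r" using D(2) by (simp add: norm_eq_sqrt_inner)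
  with 1 have "D' \<in> affine hull {P, Q} \<inter> sphere 0 r" by simp
  then have "D' = D" unfolding touch by simp
  then show "D \<bullet> (Q - P) = 0" using v by (simp add: D'_def k_def v_def)
qed

definition equilateral :: "complex \<Rightarrow> complex set" where
  "equilateral u = {u, u * \<omega>, u * \<omega>\<^sup>2}"

lemma third_root_rotation:
  assumes "norm A = 1" "norm B = 1" "A \<bullet> B = - 1/2"
  shows "B = A * \<omega> \<or> B = A * \<omega>\<^sup>2"
proof -
  define q where "q = cnj A * B"
  have A: "A * cnj A = 1" using assms(1) by (simp add: complex_norm_square[symmetric])
  have q: "Re q = -1/2" using assms(3) by (simp add: q_def inner_complex_def)
  have "norm q = 1" using assms by (simp add: q_def norm_mult)
  then have "(Im q)\<^sup>2 = 3 / 4" using q cmod_power2[of q] by (simp add: power2_eq_square)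
  then have "(Im q)\<^sup>2 = (sqrt 3 / 2)\<^sup>2" by (simp add: power_divide)
  then have "q = \<omega> \<or> q = cnj \<omega>"
    using q by (auto simp: power2_eq_iff \<omega>_def complex_eq_iff)
  moreover have "B = A * q" using A by (simp add: q_def mult.assoc[symmetric])
  ultimately show ?thesis using omega_facts(2) by auto
qed

lemma inner_neg_half_iff_midpoint:
  fixes A B :: complex
  assumes "norm A = 1" "norm B = 1"
  shows "A \<bullet> B = - 1/2 \<longleftrightarrow> norm (midpoint A B) = 1/2"
proof -
  have "A \<bullet> A = 1" "B \<bullet> B = 1" using assms by (simp_all add: norm_eq_sqrt_inner)
  then have "(norm (midpoint A B))\<^sup>2 = (1 + A \<bullet> B) / 2"
    unfolding midpoint_def power2_norm_eq_inner
    by (simp add: inner_add inner_commute algebra_simps)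
  moreover have "(norm (midpoint A B))\<^sup>2 = (1/2)\<^sup>2 \<longleftrightarrow> norm (midpoint A B) = 1/2"
    by (rule power2_eq_iff_nonneg) auto
  moreover have "(1 + A \<bullet> B) / 2 = (1/2)\<^sup>2 \<longleftrightarrow> A \<bullet> B = - 1/2" by (auto simp: power2_eq_square)
  ultimately show ?thesis by metis
qed

text \<open>The point of contact is the foot of the perpendicular from the centre, which for a chord of the
unit circle is its midpoint.\<close>

lemma chord_touch_iff:
  fixes A B D :: complex
  assumes "norm A = 1" "norm B = 1" "A \<noteq> B"
  shows "affine hull {A, B} \<inter> sphere 0 (1/2) = {D} \<longleftrightarrow> A \<bullet> B = - 1/2 \<and> D = midpoint A B"
proof
  assume t: "affine hull {A, B} \<inter> sphere 0 (1/2) = {D}"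
  note o = tangent_line_orthogonal[OF assms(3) t]
  from t have "D \<in> affine hull {A, B}" by auto
  then obtain x where x: "D = (1 - x) *\<^sub>R A + x *\<^sub>R B" unfolding affine_hull_2_eq by auto
  have AA: "A \<bullet> A = 1" "B \<bullet> B = 1" using assms by (simp_all add: norm_eq_sqrt_inner)
  have ne: "A \<bullet> B \<noteq> 1"
  proof
    assume "A \<bullet> B = 1"
    then have "(A - B) \<bullet> (A - B) = 0" using AA by (simp add: inner_diff inner_commute)
    with assms(3) show False by simp
  qed
  have "(2 * x - 1) * (1 - A \<bullet> B) = 0"
    using o(1) AA by (simp add: x inner_add inner_diff inner_commute algebra_simps)
  with ne have half: "x = 1/2" by simp
  have "D = midpoint A B" unfolding x half by (simp add: midpoint_def scaleR_add_right)
  then show "A \<bullet> B = - 1/2 \<and> D = midpoint A B"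
    using o(2) inner_neg_half_iff_midpoint[OF assms(1,2)] by simp
next
  assume h: "A \<bullet> B = - 1/2 \<and> D = midpoint A B"
  have AA: "A \<bullet> A = 1" "B \<bullet> B = 1" using assms by (simp_all add: norm_eq_sqrt_inner)
  have "X = D" if "X \<in> affine hull {A, B}" "norm X = 1/2" for X
  proof -
    from that obtain x where x: "X = (1 - x) *\<^sub>R A + x *\<^sub>R B" unfolding affine_hull_2_eq by auto
    have "X \<bullet> X = (norm X)\<^sup>2" by (simp add: power2_norm_eq_inner)
    then have "X \<bullet> X = 1/4" unfolding that(2) by (simp add: power2_eq_square)
    then have "(2 * x - 1)\<^sup>2 = 0"
      using AA h by (simp add: x inner_add inner_diff inner_commute algebra_simps power2_eq_square)
    then have "x = 1/2" by simp
    show ?thesis unfolding x \<open>x = 1/2\<close> using h by (simp add: midpoint_def scaleR_add_right)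
  qed
  moreover have "D \<in> affine hull {A, B}"
    using h unfolding affine_hull_2_eq midpoint_def
    by (intro CollectI exI[of _ "1/2"]) (simp add: scaleR_add_right)
  moreover have "norm D = 1/2" using h inner_neg_half_iff_midpoint[OF assms(1,2)] by simp
  ultimately show "affine hull {A, B} \<inter> sphere 0 (1/2) = {D}"
    unfolding sphere_def dist_0_norm by blast
qed

lemma chord_side_tangent_iff:
  assumes "norm A = 1" "norm B = 1" "A \<noteq> B"
  shows "side_tangent_at A B D (sphere 0 (1/2)) \<longleftrightarrow> A \<bullet> B = - 1/2 \<and> D = midpoint A B"
  unfolding side_tangent_at_def chord_touch_iff[OF assms] by auto

lemma inner_unit_rotation:
  fixes u x y :: complex
  assumes "norm u = 1"
  shows "(u * x) \<bullet> (u * y) = x \<bullet> y"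
proof -
  have "(Re u)\<^sup>2 + (Im u)\<^sup>2 = 1" using assms cmod_power2[of u] by simp
  moreover have "(u * x) \<bullet> (u * y) = ((Re u)\<^sup>2 + (Im u)\<^sup>2) * (x \<bullet> y)"
    by (simp add: inner_complex_def power2_eq_square algebra_simps)
  ultimately show ?thesis by simp
qed

lemma equilateral_vertices:
  assumes "norm u = 1" "A \<in> equilateral u" "B \<in> equilateral u" "A \<noteq> B"
  shows "norm A = 1" "A \<bullet> B = - 1/2"
proof -
  show "norm A = 1" using assms(1,2) omega_facts(1)
    by (auto simp: equilateral_def norm_mult norm_power)
  have w: "1 \<bullet> \<omega> = -1/2" "1 \<bullet> \<omega>\<^sup>2 = -1/2" "\<omega> \<bullet> \<omega>\<^sup>2 = -1/2"
    unfolding omega_facts(2) by (simp_all add: \<omega>_def inner_complex_def)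
  have "\<exists>x\<in>{1,\<omega>,\<omega>\<^sup>2}. A = u * x" "\<exists>x\<in>{1,\<omega>,\<omega>\<^sup>2}. B = u * x"
    using assms(2,3) by (auto simp: equilateral_def)
  then obtain x y where xy: "x \<in> {1,\<omega>,\<omega>\<^sup>2}" "A = u * x" "y \<in> {1,\<omega>,\<omega>\<^sup>2}" "B = u * y" by blast
  have "x \<bullet> y = -1/2" using xy assms(4) w by (auto simp: inner_commute)
  then show "A \<bullet> B = - 1/2" using inner_unit_rotation[OF assms(1)] xy by simp
qed

lemma equilateral_triangle:
  assumes "norm u = 1"
  shows "triangle (equilateral u)"
proof -
  have u: "u \<noteq> 0" using assms by auto
  have "card (equilateral u) = 3"
    using u omega_facts by (auto simp: equilateral_def card_insert_if)
  moreover have "\<not> collinear (equilateral u)"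
  proof
    have e: "equilateral u = {u, u * \<omega>, u * \<omega>\<^sup>2}" by (simp add: equilateral_def)
    assume "collinear (equilateral u)"
    then have "collinear {0, u * \<omega> - u, u * \<omega>\<^sup>2 - u}"
      unfolding e using collinear_3[of "u * \<omega>" u "u * \<omega>\<^sup>2"] by (simp add: insert_commute)
    then have "(u * \<omega>\<^sup>2 - u) / (u * \<omega> - u) \<in> \<real>" by (simp add: collinear_iff_Reals)
    also have "(u * \<omega>\<^sup>2 - u) / (u * \<omega> - u) = 1 + \<omega>"
    proof -
      have "u * \<omega>\<^sup>2 - u = (1 + \<omega>) * (u * \<omega> - u)" by (simp add: algebra_simps power2_eq_square)
      moreover have "u * \<omega> - u \<noteq> 0" using u omega_facts(5) by simp
      ultimately show ?thesis by simp
    qed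
    finally show False by (auto simp: complex_is_Real_iff \<omega>_def)
  qed
  ultimately show ?thesis by (simp add: triangle_def)
qed

text \<open>A chord of the unit circle touches the circle of radius \<open>1/2\<close> iff it subtends an angle of
120 degrees, so two sides at one vertex already determine the triangle.\<close>

lemma concentric_three_periodics:
  "three_periodics (sphere 0 1, sphere 0 (1/2)) = equilateral ` sphere 0 1"
proof (intro equalityI subsetI)
  fix T assume "T \<in> three_periodics (sphere 0 1, sphere 0 (1/2))"
  then have T: "triangle T" "T \<subseteq> sphere 0 1"
    and tang: "\<And>A B. A \<in> T \<Longrightarrow> B \<in> T \<Longrightarrow> A \<noteq> B \<Longrightarrow> \<exists>D. side_tangent_at A B D (sphere 0 (1/2))"
    by (auto simp: three_periodics_def)
  from T(1) obtain A B C where ABC: "T = {A, B, C}" "A \<noteq> B" "B \<noteq> C" "A \<noteq> C"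
    unfolding triangle_def card_3_iff by blast
  have n: "norm A = 1" "norm B = 1" "norm C = 1" using T(2) ABC by auto
  have "B = A * \<omega> \<or> B = A * \<omega>\<^sup>2" "C = A * \<omega> \<or> C = A * \<omega>\<^sup>2"
    using tang[of A B] tang[of A C] ABC n third_root_rotation[of A B] third_root_rotation[of A C]
    by (auto simp: chord_side_tangent_iff)
  then have "T = equilateral A" using ABC by (auto simp: equilateral_def)
  then show "T \<in> equilateral ` sphere 0 1" using n by auto
next
  fix T assume "T \<in> equilateral ` sphere 0 (1::real)"
  then obtain u where u: "norm u = 1" "T = equilateral u" by auto
  moreover from this have unit: "norm A = 1" if "A \<in> equilateral u" for A
    using that omega_facts(1) by (auto simp: equilateral_def norm_mult norm_power)
  ultimately show "T \<in> three_periodics (sphere 0 1, sphere 0 (1/2))"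
    using equilateral_triangle[OF u(1)] equilateral_vertices[OF u(1)] unit
    by (auto simp: three_periodics_def chord_side_tangent_iff)
qed

section \<open>Collineations of the disc\<close>

lemma half_sphere_in_disc: "sphere (0::complex) (1/2) \<subseteq> cball 0 1" by auto

lemma midpoint_in_disc:
  fixes a b :: complex
  assumes "norm a = 1" "norm b = 1"
  shows "midpoint a b \<in> cball 0 1"
proof -
  have "closed_segment a b \<subseteq> cball 0 1" using assms by (simp add: closed_segment_subset)
  then show ?thesis using midpoint_in_closed_segment[of a b] by blast
qed

text \<open>No formula is prescribed: these two properties are all that is needed to transport
lines, betweenness and tangency, and affine and projective maps share them.\<close>

definition disc_collineation :: "(complex \<Rightarrow> complex) \<Rightarrow> bool" where
  "disc_collineation K \<longleftrightarrow> inj_on K (cball 0 1) \<and>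
     (\<forall>A\<in>cball 0 1. \<forall>B\<in>cball 0 1. K ` closed_segment A B = closed_segment (K A) (K B))"

lemma collineation_between:
  assumes K: "disc_collineation K" and "A \<in> cball 0 1" "B \<in> cball 0 1" "X \<in> cball 0 1"
  shows "K X \<in> closed_segment (K A) (K B) \<longleftrightarrow> X \<in> closed_segment A B"
proof -
  have "closed_segment A B \<subseteq> cball 0 1" using assms by (simp add: closed_segment_subset)
  then have "K X \<in> K ` closed_segment A B \<longleftrightarrow> X \<in> closed_segment A B"
    using K assms(4) unfolding disc_collineation_def by (meson inj_on_image_mem_iff)
  then show ?thesis using assms by (simp add: disc_collineation_def)
qed

lemma collineation_collinear:
  assumes K: "disc_collineation K" and "A \<in> cball 0 1" "B \<in> cball 0 1" "X \<in> cball 0 1"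
  shows "collinear {K A, K B, K X} \<longleftrightarrow> collinear {A, B, X}"
  using assms by (simp add: collinear_between_cases between_mem_segment collineation_between)

lemma in_affine_hull_2_iff:
  "A \<noteq> B \<Longrightarrow> X \<in> affine hull {A, B} \<longleftrightarrow> collinear {A, B, X :: complex}"
  using collinear_3_affine_hull by blast

text \<open>Of three collinear points one lies between the other two, so an injective map preserving
segments carries the common points of a line and a subset of the disc to the common points of the
image line and the image set.\<close>

lemma collineation_side_tangent:
  assumes K: "disc_collineation K" and AB: "norm A \<le> 1" "norm B \<le> 1" "A \<noteq> B"
    and C: "C \<subseteq> cball 0 1" and D: "D \<in> cball 0 1"
  shows "side_tangent_at (K A) (K B) (K D) (K ` C) \<longleftrightarrow> side_tangent_at A B D C"
proof -
  have inj: "inj_on K (cball 0 1)" using K by (simp add: disc_collineation_def)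
  have ne: "K A \<noteq> K B" using inj AB by (auto simp: inj_on_def)
  have "affine hull {K A, K B} \<inter> K ` C = K ` (affine hull {A, B} \<inter> C)"
    using AB C by (auto simp: in_affine_hull_2_iff ne collineation_collinear[OF K])
  also have "\<dots> = {K D} \<longleftrightarrow> affine hull {A, B} \<inter> C = {D}"
    using inj_on_image_eq_iff[OF inj, of "affine hull {A, B} \<inter> C" "{D}"] C D by auto
  finally show ?thesis
    using collineation_between[OF K, of A B D] AB D by (simp add: side_tangent_at_def)
qed

lemma collineation_triangle:
  assumes K: "disc_collineation K" and T: "T \<subseteq> cball 0 1"
  shows "triangle (K ` T) \<longleftrightarrow> triangle T"
proof -
  have inj: "inj_on K T" using K T by (auto simp: disc_collineation_def intro: inj_on_subset)
  then have c: "card (K ` T) = card T" by (rule card_image)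
  have "collinear (K ` T) \<longleftrightarrow> collinear T" if "card T = 3"
  proof -
    from that obtain A B X where "T = {A, B, X}" unfolding card_3_iff by blast
    then show ?thesis using collineation_collinear[OF K, of A B X] T by simp
  qed
  then show ?thesis using c by (auto simp: triangle_def)
qed

text \<open>The transport principle behind both halves of the theorem.\<close>

lemma collineation_three_periodics:
  assumes K: "disc_collineation K" and C: "C \<subseteq> cball 0 1"
  shows "three_periodics (K ` sphere 0 1, K ` C) = (`) K ` three_periodics (sphere 0 1, C)"
proof -
  have inj: "inj_on K (cball 0 1)" using K by (simp add: disc_collineation_def)
  have KS: "K A \<noteq> K B \<longleftrightarrow> A \<noteq> B" if "A \<in> cball 0 1" "B \<in> cball 0 1" for A B
    using inj that by (auto simp: inj_on_def)
  have key: "K ` T \<in> three_periodics (K ` sphere 0 1, K ` C) \<longleftrightarrow> T \<in> three_periodics (sphere 0 1, C)"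
    if T: "T \<subseteq> sphere 0 1" for T
  proof -
    have T': "T \<subseteq> cball 0 1" using T by auto
    have side: "(\<exists>D. side_tangent_at (K A) (K B) D (K ` C)) \<longleftrightarrow> (\<exists>D. side_tangent_at A B D C)"
      if AB: "A \<in> T" "B \<in> T" "A \<noteq> B" for A B
    proof -
      have n: "norm A = 1" "norm B = 1" using AB T by auto
      have "D \<in> K ` C" if "side_tangent_at (K A) (K B) D (K ` C)" for D
        using that by (auto simp: side_tangent_at_def)
      moreover have "D \<in> C" if "side_tangent_at A B D C" for D
        using that by (auto simp: side_tangent_at_def)
      ultimately show ?thesis
        using collineation_side_tangent[OF K n[THEN eq_refl] AB(3) C] C by (metis imageE subsetD)
    qed
    have "(\<forall>P\<in>K ` T. \<forall>Q\<in>K ` T. P \<noteq> Q \<longrightarrow> (\<exists>D. side_tangent_at P Q D (K ` C))) \<longleftrightarrow>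
        (\<forall>A\<in>T. \<forall>B\<in>T. A \<noteq> B \<longrightarrow> (\<exists>D. side_tangent_at A B D C))"
      unfolding ball_simps(9) using side KS T' by (metis subsetD)
    moreover have "K ` T \<subseteq> K ` sphere 0 1" using T by (rule image_mono)
    ultimately show ?thesis
      using T collineation_triangle[OF K T'] by (simp add: three_periodics_def)
  qed
  show ?thesis
  proof (intro equalityI subsetI)
    fix T assume T: "T \<in> three_periodics (K ` sphere 0 1, K ` C)"
    then have "T \<subseteq> K ` sphere 0 1" by (simp add: three_periodics_def)
    then obtain T' where "T = K ` T'" "T' \<subseteq> sphere 0 1" by (auto simp: subset_image_iff)
    then show "T \<in> (`) K ` three_periodics (sphere 0 1, C)" using key T by simp
  next
    fix T assume "T \<in> (`) K ` three_periodics (sphere 0 1, C)"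
    then obtain T' where T': "T = K ` T'" "T' \<in> three_periodics (sphere 0 1, C)" by auto
    moreover from T'(2) have "T' \<subseteq> sphere 0 1" by (simp add: three_periodics_def)
    ultimately show "T \<in> three_periodics (K ` sphere 0 1, K ` C)" using key by simp
  qed
qed

text \<open>A quotient of an affine map by a positive affine function maps convex combinations to
convex combinations with reweighted coefficients.\<close>

lemma projective_image_segment:
  fixes A B :: complex and L :: "complex \<Rightarrow> complex" and d :: "complex \<Rightarrow> real"
  assumes L: "\<And>t. L ((1 - t) *\<^sub>R A + t *\<^sub>R B) = (1 - t) *\<^sub>R L A + t *\<^sub>R L B"
    and d: "\<And>t. d ((1 - t) *\<^sub>R A + t *\<^sub>R B) = (1 - t) * d A + t * d B"
    and pos: "0 < d A" "0 < d B"
  shows "(\<lambda>z. L z /\<^sub>R d z) ` closed_segment A B = closed_segment (L A /\<^sub>R d A) (L B /\<^sub>R d B)"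
proof (intro equalityI subsetI)
  fix X assume "X \<in> (\<lambda>z. L z /\<^sub>R d z) ` closed_segment A B"
  then obtain t where t: "0 \<le> t" "t \<le> 1"
    and X: "X = ((1 - t) *\<^sub>R L A + t *\<^sub>R L B) /\<^sub>R ((1 - t) * d A + t * d B)"
    by (auto simp: closed_segment_def L d)
  define e where "e = (1 - t) * d A + t * d B"
  have e: "0 < e" using t pos unfolding e_def
    by (cases "t = 0") (simp_all add: add_nonneg_pos)
  have "1 - t * d B / e = (1 - t) * d A / e" using e by (simp add: field_simps) (simp add: e_def algebra_simps)
  then have "X = (1 - t * d B / e) *\<^sub>R (L A /\<^sub>R d A) + (t * d B / e) *\<^sub>R (L B /\<^sub>R d B)"
    unfolding X e_def[symmetric] \<open>1 - t * d B / e = (1 - t) * d A / e\<close>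
    using pos by (simp add: scaleR_add_right divide_inverse mult_ac)
  moreover have "t * d B / e \<le> 1" "0 \<le> t * d B / e"
    using e t pos by (simp_all add: field_simps) (simp add: e_def)
  ultimately show "X \<in> closed_segment (L A /\<^sub>R d A) (L B /\<^sub>R d B)"
    unfolding closed_segment_def by blast
next
  fix X assume "X \<in> closed_segment (L A /\<^sub>R d A) (L B /\<^sub>R d B)"
  then obtain r where r: "0 \<le> r" "r \<le> 1"
    and X: "X = (1 - r) *\<^sub>R (L A /\<^sub>R d A) + r *\<^sub>R (L B /\<^sub>R d B)"
    by (auto simp: closed_segment_def)
  define e where "e = (1 - r) * d B + r * d A"
  define t where "t = r * d A / e"
  have e: "0 < e" using r pos unfolding e_def
    by (cases "r = 0") (simp_all add: add_nonneg_pos)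
  have t1: "1 - t = (1 - r) * d B / e" using e by (simp add: t_def field_simps) (simp add: e_def algebra_simps)
  have t01: "0 \<le> t" "t \<le> 1" using e r pos by (simp_all add: t_def field_simps) (simp add: e_def)
  have den: "(1 - t) * d A + t * d B = d A * d B / e"
    unfolding t1 unfolding t_def using e by (simp add: field_simps)
  have "((1 - t) *\<^sub>R L A + t *\<^sub>R L B) /\<^sub>R ((1 - t) * d A + t * d B) = X"
    unfolding den X unfolding t1 unfolding t_def using e pos
    by (simp add: scaleR_add_right field_simps)
  then show "X \<in> (\<lambda>z. L z /\<^sub>R d z) ` closed_segment A B"
    unfolding closed_segment_def using t01 by (force simp: L d)
qed

section \<open>Triangles up to similarity\<close>

text \<open>The discrete Fourier coefficients \<open>p\<close>, \<open>\<alpha>\<close>, \<open>\<beta>\<close> are used as coordinates because a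
map \<open>z \<mapsto> n + m z\<close> multiplies \<open>\<alpha>\<close> and \<open>\<beta>\<close> by the same factor.\<close>

definition fourier_triangle :: "complex \<Rightarrow> complex \<Rightarrow> complex \<Rightarrow> complex set" where
  "fourier_triangle p \<alpha> \<beta> = {p + \<alpha> + \<beta>, p + \<alpha> * \<omega> + \<beta> * \<omega>\<^sup>2, p + \<alpha> * \<omega>\<^sup>2 + \<beta> * \<omega>}"

text \<open>The cross product of two edge vectors is the form in which collinearity meets the computations below.\<close>

lemma collinear_cross:
  "collinear {A, B, C :: complex} \<longleftrightarrow> Re (B - A) * Im (C - A) = Im (B - A) * Re (C - A)"
proof -
  have "collinear {A, B, C} \<longleftrightarrow> collinear {0, B - A, C - A}"
    using collinear_3[of B A C] by (simp add: insert_commute)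
  also have "\<dots> \<longleftrightarrow> Im ((C - A) / (B - A)) = 0"
    by (simp add: collinear_iff_Reals complex_is_Real_iff)
  also have "\<dots> \<longleftrightarrow> Re (B - A) * Im (C - A) = Im (B - A) * Re (C - A)"
  proof (cases "B = A")
    case False
    then have "(Re (B - A))\<^sup>2 + (Im (B - A))\<^sup>2 \<noteq> 0" by (simp add: complex_eq_iff sum_power2_eq_zero_iff)
    then show ?thesis unfolding Im_divide by (auto simp: mult.commute)
  qed simp
  finally show ?thesis .
qed

text \<open>The signed area is a multiple of \<open>\<bar>\<alpha>\<bar>\<^sup>2 - \<bar>\<beta>\<bar>\<^sup>2\<close>.\<close>

lemma fourier_triangle_collinear:
  assumes "norm \<alpha> = norm \<beta>"
  shows "collinear {p + \<alpha> + \<beta>, p + \<alpha> * \<omega> + \<beta> * \<omega>\<^sup>2, p + \<alpha> * \<omega>\<^sup>2 + \<beta> * \<omega>}"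
proof -
  have "(norm \<alpha>)\<^sup>2 = (norm \<beta>)\<^sup>2" using assms by simp
  then have "Re \<alpha> * Re \<alpha> + Im \<alpha> * Im \<alpha> = Re \<beta> * Re \<beta> + Im \<beta> * Im \<beta>"
    unfolding cmod_power2 by (simp add: power2_eq_square)
  then have h: "h * (Re \<alpha> * Re \<alpha> + Im \<alpha> * Im \<alpha>) = h * (Re \<beta> * Re \<beta> + Im \<beta> * Im \<beta>)" for h by simp
  show ?thesis
    unfolding collinear_cross omega_facts(2) using h[of "sqrt 3"]
    by (simp add: \<omega>_def algebra_simps)
qed

text \<open>Inversion of the discrete Fourier transform of order three.\<close>

lemma triangle_fourier:
  fixes A B C :: complex
  obtains p \<alpha> \<beta> where "A = p + \<alpha> + \<beta>" "B = p + \<alpha> * \<omega> + \<beta> * \<omega>\<^sup>2" "C = p + \<alpha> * \<omega>\<^sup>2 + \<beta> * \<omega>"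
proof -
  have w: "\<omega>\<^sup>2 = - 1 - \<omega>" using omega_facts(4) by algebra
  have w2: "\<omega> * \<omega> = - 1 - \<omega>" using w by (simp add: power2_eq_square)
  have w2': "\<omega> * (\<omega> * x) = - x - \<omega> * x" for x
    unfolding mult.assoc[symmetric] w2 by (simp add: algebra_simps)
  show ?thesis
    by (rule that[of "(A + B + C) / 3" "(A + \<omega>\<^sup>2 * B + \<omega> * C) / 3" "(A + \<omega> * B + \<omega>\<^sup>2 * C) / 3"])
      (simp_all add: w w2 w2' field_simps)
qed

text \<open>For \<open>r < 1\<close>: up to similarity the triangles in \<open>\<F>\<close> are exactly those with
\<open>\<bar>\<beta> / \<alpha>\<bar> = r\<close>, which amounts to prescribing the Brocard angle.\<close>

definition all_shapes :: "real \<Rightarrow> complex set set \<Rightarrow> bool" where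
  "all_shapes r \<F> \<longleftrightarrow>
     (\<forall>T\<in>\<F>. \<exists>p \<alpha> \<zeta>. \<alpha> \<noteq> 0 \<and> norm \<zeta> = 1 \<and> T = fourier_triangle p \<alpha> (of_real r * \<zeta> * \<alpha>)) \<and>
     (\<forall>\<zeta>. norm \<zeta> = 1 \<longrightarrow> (\<exists>p \<alpha>. \<alpha> \<noteq> 0 \<and> fourier_triangle p \<alpha> (of_real r * \<zeta> * \<alpha>) \<in> \<F>))"

lemma complex_affine_similarity:
  assumes "m \<noteq> 0"
  shows "similarity (\<lambda>z. n + m * z)"
proof -
  have "plane_isometry (\<lambda>z. n + sgn m * z)"
    using assms by (simp add: plane_isometry_def dist_norm right_diff_distrib[symmetric] norm_mult norm_sgn)
  moreover have "plane_isometry (\<lambda>z. z)" by (simp add: plane_isometry_def)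
  moreover have "(\<lambda>z. n + m * z) = (\<lambda>z. n + sgn m * z) \<circ> (\<lambda>z. norm m *\<^sub>R z) \<circ> (\<lambda>z. z)"
    using assms by (auto simp: fun_eq_iff sgn_div_norm scaleR_conv_of_real)
  ultimately show ?thesis unfolding similarity_def using assms by (metis zero_less_norm_iff)
qed

lemma affine_image_fourier_triangle: "(\<lambda>z. n + m * z) ` fourier_triangle p \<alpha> \<beta> = fourier_triangle (n + m * p) (m * \<alpha>) (m * \<beta>)"
  by (simp add: fourier_triangle_def algebra_simps)

lemma similar_fourier_triangles:
  assumes "\<alpha> \<noteq> 0" "\<alpha>' \<noteq> 0"
  shows "\<exists>f. similarity f \<and> f ` fourier_triangle p \<alpha> (q * \<alpha>) = fourier_triangle p' \<alpha>' (q * \<alpha>')"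
proof -
  define m where "m = \<alpha>' / \<alpha>"
  have m: "m \<noteq> 0" "m * \<alpha> = \<alpha>'" using assms by (simp_all add: m_def)
  have "m * (q * \<alpha>) = q * \<alpha>'" by (subst mult.left_commute) (simp only: m(2))
  then have "(\<lambda>z. (p' - m * p) + m * z) ` fourier_triangle p \<alpha> (q * \<alpha>) = fourier_triangle p' \<alpha>' (q * \<alpha>')"
    by (simp only: affine_image_fourier_triangle m(2) diff_add_cancel)
  with complex_affine_similarity[OF m(1)] show ?thesis by blast
qed

text \<open>Triangles with equal quotient \<open>\<beta> / \<alpha>\<close> are similar, and each family realises every
quotient that occurs in the other one.\<close>

lemma all_shapes_similarity_images:
  assumes "all_shapes r \<F>" "all_shapes r \<G>"
  shows "variable_similarity_images \<F> \<G>"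
proof -
  have "\<exists>f. similarity f \<and> f ` T \<in> \<G>"
    if FG: "all_shapes r \<F>" "all_shapes r \<G>" and T: "T \<in> \<F>" for \<F> \<G> T
  proof -
    from FG(1)[unfolded all_shapes_def, THEN conjunct1, THEN bspec, OF T] obtain p \<alpha> \<zeta> where 1: "\<alpha> \<noteq> 0" "norm \<zeta> = 1" "T = fourier_triangle p \<alpha> (of_real r * \<zeta> * \<alpha>)"
      by blast
    from FG(2)[unfolded all_shapes_def, THEN conjunct2, rule_format, OF 1(2)] obtain p' \<alpha>' where 2: "\<alpha>' \<noteq> 0" "fourier_triangle p' \<alpha>' (of_real r * \<zeta> * \<alpha>') \<in> \<G>"
      by blast
    from similar_fourier_triangles[OF 1(1) 2(1), of p "of_real r * \<zeta>" p']
    obtain f where "similarity f" "f ` T = fourier_triangle p' \<alpha>' (of_real r * \<zeta> * \<alpha>')" unfolding 1(3) by blast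
    then show ?thesis using 2(2) by (intro exI[of _ f]) simp
  qed
  from this[OF assms] this[OF assms(2,1)] show ?thesis
    unfolding variable_similarity_images_def by blast
qed

lemma unit_times_norm:
  fixes z :: complex
  obtains \<xi> :: complex where "norm \<xi> = 1" "z = of_real (norm z) * \<xi>"
proof (cases "z = 0")
  case True then show ?thesis using that[of 1] by simp
next
  case False
  then have "z = of_real (norm z) * sgn z" by (simp add: sgn_div_norm scaleR_conv_of_real)
  with False show ?thesis using that[of "sgn z"] by (simp add: norm_sgn)
qed

section \<open>Homothetic pairs\<close>

text \<open>The general real affine map of the plane in complex form; it is bijective when
\<open>\<bar>\<beta>\<bar> < \<bar>\<alpha>\<bar>\<close>, as its determinant is \<open>\<bar>\<alpha>\<bar>\<^sup>2 - \<bar>\<beta>\<bar>\<^sup>2\<close>.\<close>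

definition real_affine_map :: "complex \<Rightarrow> complex \<Rightarrow> complex \<Rightarrow> complex \<Rightarrow> complex" where
  "real_affine_map c \<alpha> \<beta> z = c + \<alpha> * z + \<beta> * cnj z"

lemma real_affine_map_bij:
  assumes "norm \<beta> < norm \<alpha>"
  shows "bij (real_affine_map c \<alpha> \<beta>)"
proof (rule bijI)
  show "inj (real_affine_map c \<alpha> \<beta>)"
  proof (rule injI)
    fix x y assume "real_affine_map c \<alpha> \<beta> x = real_affine_map c \<alpha> \<beta> y"
    then have "\<alpha> * (x - y) = - (\<beta> * cnj (x - y))"
      by (simp add: real_affine_map_def algebra_simps)
    then have "norm (\<alpha> * (x - y)) = norm (\<beta> * cnj (x - y))" by (simp only: norm_minus_cancel)
    then have "norm \<alpha> * norm (x - y) = norm \<beta> * norm (x - y)" by (metis norm_mult complex_mod_cnj)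
    then show "x = y" using assms by auto
  qed
  show "surj (real_affine_map c \<alpha> \<beta>)"
  proof (rule surjI)
    fix X
    define N where "N = \<alpha> * cnj \<alpha> - \<beta> * cnj \<beta>"
    have "N = of_real ((norm \<alpha>)\<^sup>2 - (norm \<beta>)\<^sup>2)" unfolding N_def complex_norm_square[symmetric] by simp
    moreover have "(norm \<beta>)\<^sup>2 < (norm \<alpha>)\<^sup>2" using assms by (simp add: power_strict_mono)
    ultimately have N: "N \<noteq> 0" "cnj N = N" by (simp_all only: of_real_eq_0_iff complex_cnj_complex_of_real)
    \<comment> \<open>Solves the equation \<open>\<alpha> z + \<beta> \<cdot> cnj z = X - c\<close> together with its conjugate.\<close>
    let ?z = "(cnj \<alpha> * (X - c) - \<beta> * cnj (X - c)) / N"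
    have "cnj ?z = (\<alpha> * cnj (X - c) - cnj \<beta> * (X - c)) / N" by (simp add: N)
    then have "real_affine_map c \<alpha> \<beta> ?z = c + (\<alpha> * (cnj \<alpha> * (X - c) - \<beta> * cnj (X - c)) + \<beta> * (\<alpha> * cnj (X - c) - cnj \<beta> * (X - c))) / N"
      unfolding real_affine_map_def by (simp only: add_divide_distrib times_divide_eq_right add.assoc)
    also have "\<alpha> * (cnj \<alpha> * (X - c) - \<beta> * cnj (X - c)) + \<beta> * (\<alpha> * cnj (X - c) - cnj \<beta> * (X - c)) = N * (X - c)"
      by (simp add: N_def algebra_simps)
    finally show "real_affine_map c \<alpha> \<beta> ?z = X" using N by simp
  qed
qed

lemma real_affine_map_affine:
  assumes "x + y + z = 1"
  shows "real_affine_map c \<alpha> \<beta> (x *\<^sub>R A + y *\<^sub>R B + z *\<^sub>R C) = x *\<^sub>R real_affine_map c \<alpha> \<beta> A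
    + y *\<^sub>R real_affine_map c \<alpha> \<beta> B + z *\<^sub>R real_affine_map c \<alpha> \<beta> C"
proof -
  have "complex_of_real x + complex_of_real y + complex_of_real z = 1"
    using assms by (metis of_real_1 of_real_add)
  then have "c = of_real x * c + of_real y * c + of_real z * c" by (metis distrib_right mult_1)
  then show ?thesis
    unfolding real_affine_map_def scaleR_conv_of_real
    by (simp add: algebra_simps)
qed

lemma real_affine_map_collineation:
  assumes "norm \<beta> < norm \<alpha>"
  shows "disc_collineation (real_affine_map c \<alpha> \<beta>)"
proof -
  have "inj_on (real_affine_map c \<alpha> \<beta>) (cball 0 1)"
    using real_affine_map_bij[OF assms] by (meson bij_is_inj inj_on_subset subset_UNIV)
  moreover have "real_affine_map c \<alpha> \<beta> ` closed_segment A B =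
      closed_segment (real_affine_map c \<alpha> \<beta> A) (real_affine_map c \<alpha> \<beta> B)" for A B
    using projective_image_segment[where d = "\<lambda>_. 1" and L = "real_affine_map c \<alpha> \<beta>" and A = A and B = B]
      real_affine_map_affine[where z = 0] by simp
  ultimately show ?thesis unfolding disc_collineation_def by blast
qed

lemma real_affine_map_equilateral:
  "real_affine_map c \<alpha> \<beta> ` equilateral u = fourier_triangle c (\<alpha> * u) (\<beta> * cnj u)"
proof -
  have "cnj (\<omega>\<^sup>2) = \<omega>" using omega_facts(2) by simp
  then show ?thesis
    using omega_facts(2)[symmetric] by (simp add: equilateral_def real_affine_map_def fourier_triangle_def mult.assoc)
qed

text \<open>The equilateral triangle of \<open>u\<close> has quotient \<open>(\<beta> / \<alpha>) (cnj u)\<^sup>2\<close> after the map. Squaring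
is onto the unit circle, so the quotient takes every value of modulus \<open>\<bar>\<beta>\<bar> / \<bar>\<alpha>\<bar>\<close>.\<close>

lemma all_shapes_affine:
  assumes "norm \<beta> < norm \<alpha>"
  shows "all_shapes (norm \<beta> / norm \<alpha>) (three_periodics
    (real_affine_map c \<alpha> \<beta> ` sphere 0 1, real_affine_map c \<alpha> \<beta> ` sphere 0 (1/2)))"
proof -
  define r where "r = norm \<beta> / norm \<alpha>"
  have \<alpha>: "\<alpha> \<noteq> 0" using assms by auto
  obtain \<xi> where \<xi>: "norm \<xi> = 1" "\<beta> / \<alpha> = of_real (norm (\<beta> / \<alpha>)) * \<xi>" using unit_times_norm[of "\<beta> / \<alpha>"] by blast
  then have \<beta>: "\<beta> = of_real r * \<xi> * \<alpha>" using \<alpha> by (simp add: r_def norm_divide field_simps)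
  have per: "three_periodics (real_affine_map c \<alpha> \<beta> ` sphere 0 1, real_affine_map c \<alpha> \<beta> ` sphere 0 (1/2))
      = (\<lambda>u. fourier_triangle c (\<alpha> * u) (\<beta> * cnj u)) ` sphere 0 1"
    using collineation_three_periodics[OF real_affine_map_collineation[OF assms], of "sphere 0 (1/2)" c, OF half_sphere_in_disc]
    by (simp add: concentric_three_periodics image_image real_affine_map_equilateral)
  have shape: "\<beta> * cnj u = of_real r * (\<xi> * (cnj u)\<^sup>2) * (\<alpha> * u)" if "norm u = 1" for u
  proof -
    have "u * cnj u = 1" using that by (simp add: complex_norm_square[symmetric])
    moreover have "of_real r * (\<xi> * (cnj u)\<^sup>2) * (\<alpha> * u) = of_real r * \<xi> * \<alpha> * cnj u * (u * cnj u)"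
      by (simp add: power2_eq_square)
    ultimately show ?thesis unfolding \<beta> by (simp only: mult_1_right)
  qed
  show ?thesis
    unfolding all_shapes_def r_def[symmetric] per
  proof (intro conjI ballI allI impI)
    fix T assume "T \<in> (\<lambda>u. fourier_triangle c (\<alpha> * u) (\<beta> * cnj u)) ` sphere 0 1"
    then obtain u where u: "norm u = 1" "T = fourier_triangle c (\<alpha> * u) (\<beta> * cnj u)" by auto
    then show "\<exists>p \<alpha> \<zeta>. \<alpha> \<noteq> 0 \<and> cmod \<zeta> = 1 \<and> T = fourier_triangle p \<alpha> (complex_of_real r * \<zeta> * \<alpha>)"
      using shape[OF u(1)] \<alpha> \<xi>(1)
      by (intro exI[where x = c] exI[where x = "\<alpha> * u"] exI[where x = "\<xi> * (cnj u)\<^sup>2"])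
        (auto simp: norm_mult norm_power)
  next
    fix \<zeta> :: complex assume \<zeta>: "norm \<zeta> = 1"
    \<comment> \<open>A solution of \<open>\<xi> (cnj u)\<^sup>2 = \<zeta>\<close>.\<close>
    define u where "u = cnj (csqrt (\<zeta> / \<xi>))"
    have "\<xi> \<noteq> 0" using \<xi> by auto
    then have "\<xi> * (cnj u)\<^sup>2 = \<zeta>" by (simp add: u_def)
    moreover have u: "norm u = 1" using \<zeta> \<xi> by (simp add: u_def norm_divide)
    moreover have "\<alpha> * u \<noteq> 0" using \<alpha> u by auto
    moreover have "fourier_triangle c (\<alpha> * u) (\<beta> * cnj u) \<in> (\<lambda>u. fourier_triangle c (\<alpha> * u) (\<beta> * cnj u)) ` sphere 0 1"
      using u by simp
    ultimately show "\<exists>p \<alpha>'. \<alpha>' \<noteq> 0 \<and> fourier_triangle p \<alpha>' (complex_of_real r * \<zeta> * \<alpha>')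
        \<in> (\<lambda>u. fourier_triangle c (\<alpha> * u) (\<beta> * cnj u)) ` sphere 0 1"
      unfolding shape[OF u] by blast
  qed
qed

text \<open>Stretching by \<open>a\<close> and \<open>b\<close> along the axes is \<open>z \<mapsto> (a + b)/2 \<cdot> z + (a - b)/2 \<cdot> cnj z\<close>.\<close>

lemma ellipse_affine_image:
  assumes "0 < a" "0 < b" "0 < k"
  shows "ellipse c \<theta> (a * k) (b * k) =
    real_affine_map c (cis \<theta> * of_real ((a + b) / 2)) (cis \<theta> * of_real ((a - b) / 2)) ` sphere 0 k"
proof -
  have M: "real_affine_map c (cis \<theta> * of_real ((a + b) / 2)) (cis \<theta> * of_real ((a - b) / 2)) z
      = c + cis \<theta> * Complex (a * Re z) (b * Im z)" for z
  proof -
    have "of_real ((a + b) / 2) * z + of_real ((a - b) / 2) * cnj z = Complex (a * Re z) (b * Im z)"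
      by (simp add: complex_eq_iff field_simps)
    then show ?thesis
      unfolding real_affine_map_def add.assoc mult.assoc distrib_left[symmetric] by (simp only:)
  qed
  show ?thesis
  proof (intro equalityI subsetI)
    fix X assume "X \<in> ellipse c \<theta> (a * k) (b * k)"
    then obtain x y where X: "X = c + cis \<theta> * Complex x y" and xy: "(x / (a * k))\<^sup>2 + (y / (b * k))\<^sup>2 = 1"
      by (auto simp: ellipse_def)
    define z where "z = Complex (x / a) (y / b)"
    have "(norm z)\<^sup>2 = k\<^sup>2 * ((x / (a * k))\<^sup>2 + (y / (b * k))\<^sup>2)"
      using assms by (simp add: z_def cmod_power2 power_divide power_mult_distrib distrib_left)
    then have "norm z = k" using xy assms by simp
    moreover have "X = c + cis \<theta> * Complex (a * Re z) (b * Im z)" using assms by (simp add: z_def X)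
    ultimately show "X \<in> real_affine_map c (cis \<theta> * of_real ((a + b) / 2)) (cis \<theta> * of_real ((a - b) / 2)) ` sphere 0 k"
      unfolding M by auto
  next
    fix X assume "X \<in> real_affine_map c (cis \<theta> * of_real ((a + b) / 2)) (cis \<theta> * of_real ((a - b) / 2)) ` sphere 0 k"
    then obtain z where z: "norm z = k" "X = c + cis \<theta> * Complex (a * Re z) (b * Im z)"
      unfolding M by auto
    have "(a * Re z / (a * k))\<^sup>2 + (b * Im z / (b * k))\<^sup>2 = (norm z)\<^sup>2 / k\<^sup>2"
      using assms by (simp add: cmod_power2 power_divide add_divide_distrib)
    also have "\<dots> = 1" using z assms by simp
    finally show "X \<in> ellipse c \<theta> (a * k) (b * k)" using z(2) unfolding ellipse_def by blast
  qed
qed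

lemma all_shapes_homothetic:
  assumes "0 < a" "0 < b"
  shows "all_shapes (\<bar>a - b\<bar> / (a + b)) (three_periodics (ellipse c \<theta> a b, ellipse c \<theta> (a / 2) (b / 2)))"
proof -
  let ?\<alpha> = "cis \<theta> * of_real ((a + b) / 2)" and ?\<beta> = "cis \<theta> * of_real ((a - b) / 2)"
  have n: "norm ?\<alpha> = (a + b) / 2" "norm ?\<beta> = \<bar>a - b\<bar> / 2"
    using assms by (simp_all only: norm_mult norm_cis norm_of_real) auto
  then have "norm ?\<beta> < norm ?\<alpha>" using assms by simp
  then show ?thesis
    using all_shapes_affine[of ?\<beta> ?\<alpha> c] ellipse_affine_image[OF assms, of 1 c \<theta>]
      ellipse_affine_image[OF assms, of "1/2" c \<theta>] unfolding n by (simp add: n)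
qed

section \<open>Klein maps of the disc\<close>

text \<open>The denominator of the projective map \<open>klein\<close>; for \<open>\<bar>s\<bar> < 1\<close> its zero line misses the closed disc.\<close>

definition klein_denom :: "real \<Rightarrow> complex \<Rightarrow> real" where
  "klein_denom s z = 1 + s\<^sup>2 + 2 * s * Re z"

text \<open>The hyperbolic translation along the real axis in the Klein model of the disc: in coordinates
\<open>(x, y)\<close> it is the projective map with numerators \<open>(1 + s\<^sup>2) x + 2 s\<close> and \<open>(1 - s\<^sup>2) y\<close> and common
denominator \<open>1 + s\<^sup>2 + 2 s x\<close>.\<close>

definition klein :: "real \<Rightarrow> complex \<Rightarrow> complex" where
  "klein s z = (z + 2 * of_real s + (of_real s)\<^sup>2 * cnj z) / of_real (klein_denom s z)"

lemma klein_denom_pos: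
  assumes "\<bar>s\<bar> < 1" "norm z \<le> 1"
  shows "0 < klein_denom s z"
proof -
  have "\<bar>s * Re z\<bar> \<le> \<bar>s\<bar> * 1"
    using abs_Re_le_cmod[of z] assms(2) by (simp only: abs_mult) (rule mult_left_mono, auto)
  moreover have "0 < (1 - \<bar>s\<bar>)\<^sup>2" using assms by simp
  moreover have "(1 - \<bar>s\<bar>)\<^sup>2 = 1 + s\<^sup>2 - 2 * \<bar>s\<bar>" by (simp add: power2_diff)
  ultimately show ?thesis unfolding klein_denom_def by linarith
qed

lemma klein_Complex:
  "klein s (Complex x y) = Complex (((1 + s\<^sup>2) * x + 2 * s) / klein_denom s (Complex x y))
     ((1 - s\<^sup>2) * y / klein_denom s (Complex x y))"
  unfolding klein_def
  by (simp add: complex_eq_iff Re_divide_of_real Im_divide_of_real algebra_simps flip: of_real_power)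

text \<open>Translations by opposite distances cancel. The hypothesis on the denominator, rather than
membership in the disc, lets the lemma apply to points not yet known to lie in it.\<close>

lemma klein_inverse:
  assumes "klein_denom s z \<noteq> 0" "\<bar>s\<bar> < 1"
  shows "klein (- s) (klein s z) = z" "klein_denom (- s) (klein s z) \<noteq> 0"
proof -
  define d where "d = klein_denom s z"
  have d: "d \<noteq> 0" using assms by (simp add: d_def)
  have s: "1 - s\<^sup>2 \<noteq> 0" using assms(2) by (simp add: abs_square_eq_1)
  obtain x y where z: "z = Complex x y" by (cases z)
  have dx: "d = 1 + s\<^sup>2 + 2 * s * x" by (simp add: d_def klein_denom_def z)
  have k: "klein s z = Complex (((1 + s\<^sup>2) * x + 2 * s) / d) ((1 - s\<^sup>2) * y / d)"
    unfolding d_def z by (rule klein_Complex)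
  have d': "klein_denom (- s) (klein s z) = (1 - s\<^sup>2)\<^sup>2 / d"
    using d unfolding klein_denom_def k by (simp add: field_simps) (simp only: dx, algebra)
  then show "klein_denom (- s) (klein s z) \<noteq> 0" using d s by simp
  have "(1 + (- s)\<^sup>2) * (((1 + s\<^sup>2) * x + 2 * s) / d) + 2 * (- s) = (1 - s\<^sup>2)\<^sup>2 * x / d"
    using d by (simp add: field_simps) (simp only: dx, algebra)
  moreover have "(1 - (- s)\<^sup>2) * ((1 - s\<^sup>2) * y / d) = (1 - s\<^sup>2)\<^sup>2 * y / d"
    by (simp add: power2_eq_square)
  moreover have "klein (- s) (klein s z) =
      Complex (((1 + (- s)\<^sup>2) * (((1 + s\<^sup>2) * x + 2 * s) / d) + 2 * (- s)) / ((1 - s\<^sup>2)\<^sup>2 / d))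
        ((1 - (- s)\<^sup>2) * ((1 - s\<^sup>2) * y / d) / ((1 - s\<^sup>2)\<^sup>2 / d))"
    unfolding d'[symmetric] unfolding k by (rule klein_Complex)
  ultimately have "klein (- s) (klein s z) = Complex (((1 - s\<^sup>2)\<^sup>2 * x / d) / ((1 - s\<^sup>2)\<^sup>2 / d))
      (((1 - s\<^sup>2)\<^sup>2 * y / d) / ((1 - s\<^sup>2)\<^sup>2 / d))"
    by (simp only:)
  then show "klein (- s) (klein s z) = z" using d s by (simp add: z)
qed

text \<open>On the boundary the Klein model and the Poincare model of the hyperbolic plane agree, so the
projective map acts there as a Moebius transformation. This gives access to the power series used in
\<open>klein_fourier\<close>.\<close>

lemma klein_on_circle:
  assumes "norm z = 1" "\<bar>s\<bar> < 1"
  shows "klein s z = (z + of_real s) / (1 + of_real s * z)" "of_real (klein_denom s z) = (1 + of_real s * z) * cnj (1 + of_real s * z)"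
   "1 + of_real s * z \<noteq> 0"
proof -
  have zz: "z * cnj z = 1" using assms(1) by (simp add: complex_norm_square[symmetric])
  have "norm (of_real s * z) < 1" using assms by (simp add: norm_mult)
  then show ne: "1 + of_real s * z \<noteq> 0"
    by (metis add_eq_0_iff norm_minus_cancel norm_one order_less_irrefl)
  have "(1 + of_real s * z) * cnj (1 + of_real s * z) = 1 + (of_real s)\<^sup>2 * (z * cnj z) + of_real s * (z + cnj z)"
    by (simp add: algebra_simps power2_eq_square)
  also have "\<dots> = of_real (klein_denom s z)"
    unfolding zz complex_add_cnj by (simp add: klein_denom_def)
  finally show den: "of_real (klein_denom s z) = (1 + of_real s * z) * cnj (1 + of_real s * z)" by simp
  have "(z + of_real s) * cnj (1 + of_real s * z) = z + of_real s + of_real s * (z * cnj z) + (of_real s)\<^sup>2 * cnj z"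
    by (simp add: algebra_simps power2_eq_square)
  also have "\<dots> = z + 2 * of_real s + (of_real s)\<^sup>2 * cnj z" by (simp add: zz)
  finally have num: "z + 2 * of_real s + (of_real s)\<^sup>2 * cnj z = (z + of_real s) * cnj (1 + of_real s * z)" ..
  have "cnj (1 + of_real s * z) \<noteq> 0" using ne by (simp only: complex_cnj_zero_iff not_False_eq_True)
  then show "klein s z = (z + of_real s) / (1 + of_real s * z)"
    unfolding klein_def den num by (rule mult_divide_mult_cancel_right)
qed

lemma norm_klein_on_circle:
  assumes "norm z = 1" "\<bar>s\<bar> < 1"
  shows "norm (klein s z) = 1"
proof -
  have zz: "z * cnj z = 1" using assms(1) by (simp add: complex_norm_square[symmetric])
  have "z * cnj (1 + of_real s * z) = z + of_real s" 
    using zz by (simp add: algebra_simps)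
  then have "norm (z + of_real s) = norm (1 + of_real s * z)"
    using assms(1) by (metis complex_mod_cnj mult_1 norm_mult)
  then show ?thesis using klein_on_circle[OF assms] by (simp add: norm_divide)
qed

text \<open>The classical formula for the effect of a Moebius map on distances.\<close>

lemma klein_chord_length:
  assumes "norm w = 1" "norm w' = 1" "\<bar>s\<bar> < 1"
  shows "(norm (klein s w - klein s w'))\<^sup>2 =
    (1 - s\<^sup>2)\<^sup>2 * (norm (w - w'))\<^sup>2 / (klein_denom s w * klein_denom s w')"
proof -
  define \<sigma> where "\<sigma> = complex_of_real s"
  note k = klein_on_circle[OF assms(1,3), folded \<sigma>_def] and k' = klein_on_circle[OF assms(2,3), folded \<sigma>_def]
  have den: "(norm (1 + \<sigma> * z))\<^sup>2 = klein_denom s z" if "norm z = 1" for z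
  proof -
    have "complex_of_real ((norm (1 + \<sigma> * z))\<^sup>2) = of_real (klein_denom s z)"
      unfolding complex_norm_square \<sigma>_def using klein_on_circle(2)[OF that assms(3)] by (rule sym)
    then show ?thesis by (simp only: of_real_eq_iff)
  qed
  have "klein s w - klein s w' = (1 - \<sigma>\<^sup>2) * (w - w') / ((1 + \<sigma> * w) * (1 + \<sigma> * w'))"
    unfolding k(1) k'(1) diff_frac_eq[OF k(3) k'(3)] by (rule arg_cong2[where f = "(/)"]) (algebra, rule refl)
  moreover have "norm (1 - \<sigma>\<^sup>2) = \<bar>1 - s\<^sup>2\<bar>"
    unfolding \<sigma>_def by (metis norm_of_real of_real_1 of_real_diff of_real_power)
  ultimately show ?thesis
    by (simp add: norm_divide norm_mult power_divide power_mult_distrib den assms)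
qed

text \<open>Up to a similarity these are all the collineations needed for Brocard porisms; the
direction of the hyperbolic translation is absorbed into the argument of \<open>m\<close> and the choice of the
equilateral triangle.\<close>

definition brocard_map :: "real \<Rightarrow> complex \<Rightarrow> complex \<Rightarrow> complex \<Rightarrow> complex" where
  "brocard_map s m n z = n + m * klein s z"

lemma brocard_map_projective:
  assumes "\<bar>s\<bar> < 1" "norm z \<le> 1"
  shows "brocard_map s m n z =
    (klein_denom s z *\<^sub>R n + m * (z + 2 * of_real s + (of_real s)\<^sup>2 * cnj z)) /\<^sub>R klein_denom s z"
  using klein_denom_pos[OF assms]
  by (simp add: brocard_map_def klein_def scaleR_conv_of_real field_simps)

lemma brocard_map_collineation:
  assumes "\<bar>s\<bar> < 1" "m \<noteq> 0"
  shows "disc_collineation (brocard_map s m n)"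
  unfolding disc_collineation_def
proof (intro conjI ballI)
  show "inj_on (brocard_map s m n) (cball 0 1)"
  proof (rule inj_onI)
    fix x y :: complex assume xy: "x \<in> cball 0 1" "y \<in> cball 0 1" "brocard_map s m n x = brocard_map s m n y"
    then have "klein s x = klein s y" using assms by (simp add: brocard_map_def)
    then show "x = y"
      using klein_inverse(1)[OF _ assms(1)] klein_denom_pos[OF assms(1)] xy(1,2)
      by (metis mem_cball_0 order_less_irrefl)
  qed
next
  fix A B :: complex assume AB: "A \<in> cball 0 1" "B \<in> cball 0 1"
  let ?L = "\<lambda>z. klein_denom s z *\<^sub>R n + m * (z + 2 * of_real s + (of_real s)\<^sup>2 * cnj z)"
  have d: "klein_denom s ((1 - t) *\<^sub>R A + t *\<^sub>R B) = (1 - t) * klein_denom s A + t * klein_denom s B" for t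
    by (simp add: klein_denom_def algebra_simps)
  have eq: "brocard_map s m n z = ?L z /\<^sub>R klein_denom s z" if "z \<in> closed_segment A B" for z
    using that AB brocard_map_projective[OF assms(1)] closed_segment_subset[OF AB] by auto
  have "brocard_map s m n ` closed_segment A B = (\<lambda>z. ?L z /\<^sub>R klein_denom s z) ` closed_segment A B"
    using eq by (rule image_cong[OF refl])
  also have "\<dots> = closed_segment (?L A /\<^sub>R klein_denom s A) (?L B /\<^sub>R klein_denom s B)"
    using AB klein_denom_pos[OF assms(1)]
    by (intro projective_image_segment d)
      (simp_all only: d, simp_all add: scaleR_conv_of_real algebra_simps)
  finally show "brocard_map s m n ` closed_segment A B =
      closed_segment (brocard_map s m n A) (brocard_map s m n B)"
    using eq by simp
qed

lemma brocard_map_circle: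
  assumes "\<bar>s\<bar> < 1" "m \<noteq> 0"
  shows "brocard_map s m n ` sphere 0 1 = sphere n (norm m)"
proof (intro equalityI subsetI)
  fix X assume "X \<in> brocard_map s m n ` sphere 0 1"
  then show "X \<in> sphere n (norm m)"
    using norm_klein_on_circle[OF _ assms(1)] by (auto simp: brocard_map_def dist_norm norm_mult)
next
  fix X assume X: "X \<in> sphere n (norm m)"
  define W where "W = (X - n) / m"
  have W: "norm W = 1" using X assms by (simp add: W_def norm_divide dist_norm norm_minus_commute)
  have "klein_denom (- s) W \<noteq> 0" using klein_denom_pos[of "- s" W] W assms by simp
  then have "klein s (klein (- s) W) = W" using klein_inverse(1)[of "- s" W] assms by simp
  then have "X = brocard_map s m n (klein (- s) W)" using assms by (simp add: brocard_map_def W_def)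
  moreover have "norm (klein (- s) W) = 1" using norm_klein_on_circle[of W "- s"] W assms by simp
  ultimately show "X \<in> brocard_map s m n ` sphere 0 1" by auto
qed

text \<open>The equation of the image curve, obtained by substituting the inverse map.\<close>

lemma klein_inner_circle_equation:
  assumes "\<bar>s\<bar> < 1" "klein_denom (- s) (Complex X Y) \<noteq> 0"
  shows "norm (klein (- s) (Complex X Y)) = 1/2 \<longleftrightarrow>
    4 * (((1 + s\<^sup>2) * X - 2 * s)\<^sup>2 + ((1 - s\<^sup>2) * Y)\<^sup>2) = (1 + s\<^sup>2 - 2 * s * X)\<^sup>2"
proof -
  define d where "d = klein_denom (- s) (Complex X Y)"
  have d: "d \<noteq> 0" "d = 1 + s\<^sup>2 - 2 * s * X" using assms by (simp_all add: d_def klein_denom_def)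
  have "klein (- s) (Complex X Y) = Complex (((1 + s\<^sup>2) * X - 2 * s) / d) ((1 - s\<^sup>2) * Y / d)"
    using klein_Complex[of "- s" X Y] by (simp add: d_def)
  then have "(norm (klein (- s) (Complex X Y)))\<^sup>2 = (((1 + s\<^sup>2) * X - 2 * s)\<^sup>2 + ((1 - s\<^sup>2) * Y)\<^sup>2) / d\<^sup>2"
    by (simp add: cmod_power2 power_divide add_divide_distrib)
  moreover have "norm (klein (- s) (Complex X Y)) = 1/2 \<longleftrightarrow> (norm (klein (- s) (Complex X Y)))\<^sup>2 = (1/2)\<^sup>2"
    by (rule power2_eq_iff_nonneg[symmetric]) auto
  moreover have "q / d\<^sup>2 = (1/2)\<^sup>2 \<longleftrightarrow> 4 * q = d\<^sup>2" for q
    using d(1) by (auto simp: field_simps power2_eq_square)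
  ultimately show ?thesis unfolding d(2)[symmetric] by simp
qed

text \<open>Completing the square in the equation of \<open>klein_inner_circle_equation\<close> gives the centre on
the real axis and the two semi-axes.\<close>

definition klein_centre :: "real \<Rightarrow> real" where
  "klein_centre s = 3 * s * (1 + s\<^sup>2) / (2 * (1 + s\<^sup>2 + s^4))"
definition klein_major :: "real \<Rightarrow> real" where
  "klein_major s = (1 - s\<^sup>2)\<^sup>2 / (2 * (1 + s\<^sup>2 + s^4))"
definition klein_minor :: "real \<Rightarrow> real" where
  "klein_minor s = (1 - s\<^sup>2) / (2 * sqrt (1 + s\<^sup>2 + s^4))"

lemma klein_axes_pos:
  assumes "\<bar>s\<bar> < 1" shows "0 < klein_major s" "0 < klein_minor s"
proof -
  have "0 < 1 - s\<^sup>2" using assms by (simp add: abs_square_less_1)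
  moreover have "0 < 1 + s\<^sup>2 + s^4" by (simp add: add_pos_nonneg)
  ultimately show "0 < klein_major s" "0 < klein_minor s" by (simp_all add: klein_major_def klein_minor_def)
qed

text \<open>Both equations are the same conic up to the positive factor \<open>1 + s\<^sup>2 + s^4\<close>.\<close>

lemma klein_ellipse_equation:
  assumes "\<bar>s\<bar> < 1"
  shows "((X - klein_centre s) / klein_major s)\<^sup>2 + (Y / klein_minor s)\<^sup>2 = 1 \<longleftrightarrow>
    4 * (((1 + s\<^sup>2) * X - 2 * s)\<^sup>2 + ((1 - s\<^sup>2) * Y)\<^sup>2) = (1 + s\<^sup>2 - 2 * s * X)\<^sup>2"
proof -
  define e where "e = 1 + s\<^sup>2 + s^4"
  define f where "f = 1 - s\<^sup>2"
  have e: "0 < e" by (simp add: e_def add_pos_nonneg)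
  have f: "0 < f" using assms by (simp add: f_def abs_square_less_1)
  have "((X - klein_centre s) / klein_major s)\<^sup>2 = (2 * e * X - 3 * s * (1 + s\<^sup>2))\<^sup>2 / f^4"
    using e f unfolding klein_centre_def klein_major_def e_def[symmetric] f_def[symmetric]
    by (simp add: field_simps power2_eq_square power4_eq_xxxx)
  moreover have "(Y / klein_minor s)\<^sup>2 = 4 * e * Y\<^sup>2 / f\<^sup>2"
    using e f unfolding klein_minor_def e_def[symmetric] f_def[symmetric]
    by (simp add: power_divide power_mult_distrib)
  moreover have clear: "A / f^4 + B / f\<^sup>2 = 1 \<longleftrightarrow> A + B * f\<^sup>2 - f^4 = 0" for A B
    using f by (auto simp: field_simps power2_eq_square power4_eq_xxxx)
  ultimately have "((X - klein_centre s) / klein_major s)\<^sup>2 + (Y / klein_minor s)\<^sup>2 = 1 \<longleftrightarrow>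
      (2 * e * X - 3 * s * (1 + s\<^sup>2))\<^sup>2 + 4 * e * f\<^sup>2 * Y\<^sup>2 - f^4 = 0"
    using clear[of "(2 * e * X - 3 * s * (1 + s\<^sup>2))\<^sup>2" "4 * e * Y\<^sup>2"] by (simp add: mult_ac)
  also have "(2 * e * X - 3 * s * (1 + s\<^sup>2))\<^sup>2 + 4 * e * f\<^sup>2 * Y\<^sup>2 - f^4 =
      e * (4 * (((1 + s\<^sup>2) * X - 2 * s)\<^sup>2 + (f * Y)\<^sup>2) - (1 + s\<^sup>2 - 2 * s * X)\<^sup>2)"
    unfolding e_def f_def by algebra
  finally show ?thesis using e by (simp add: f_def)
qed

lemma klein_inner_circle:
  assumes "\<bar>s\<bar> < 1"
  shows "klein s ` sphere 0 (1/2) = ellipse (of_real (klein_centre s)) 0 (klein_major s) (klein_minor s)"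
proof -
  have mem: "Complex X Y \<in> ellipse (of_real (klein_centre s)) 0 (klein_major s) (klein_minor s) \<longleftrightarrow>
      ((X - klein_centre s) / klein_major s)\<^sup>2 + (Y / klein_minor s)\<^sup>2 = 1" for X Y
  proof
    assume "((X - klein_centre s) / klein_major s)\<^sup>2 + (Y / klein_minor s)\<^sup>2 = 1"
    then show "Complex X Y \<in> ellipse (of_real (klein_centre s)) 0 (klein_major s) (klein_minor s)"
      unfolding ellipse_def
      by (intro CollectI exI[of _ "X - klein_centre s"] exI[of _ Y]) (simp add: complex_eq_iff)
  qed (auto simp: ellipse_def complex_eq_iff)
  show ?thesis
  proof (intro equalityI subsetI)
    fix W assume "W \<in> klein s ` sphere 0 (1/2)"
    then obtain z where z: "norm z = 1/2" "W = klein s z" by auto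
    obtain X Y where W: "W = Complex X Y" by (cases W)
    have "klein_denom s z \<noteq> 0" using klein_denom_pos[OF assms, of z] z by simp
    note inv = klein_inverse[OF this assms, folded z(2), unfolded W]
    show "W \<in> ellipse (of_real (klein_centre s)) 0 (klein_major s) (klein_minor s)"
      unfolding W mem klein_ellipse_equation[OF assms]
      using klein_inner_circle_equation[OF assms inv(2)] inv(1) z(1) by simp
  next
    fix W assume W': "W \<in> ellipse (of_real (klein_centre s)) 0 (klein_major s) (klein_minor s)"
    obtain X Y where W: "W = Complex X Y" by (cases W)
    have eq: "4 * (((1 + s\<^sup>2) * X - 2 * s)\<^sup>2 + ((1 - s\<^sup>2) * Y)\<^sup>2) = (1 + s\<^sup>2 - 2 * s * X)\<^sup>2"
      using W' unfolding W mem klein_ellipse_equation[OF assms] .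
    \<comment> \<open>If the denominator vanished, so would both squares on the left of the equation, which
      is possible only for \<open>s\<^sup>2 = 1\<close>.\<close>
    have d: "klein_denom (- s) (Complex X Y) \<noteq> 0"
    proof
      assume "klein_denom (- s) (Complex X Y) = 0"
      then have 0: "1 + s\<^sup>2 - 2 * s * X = 0" by (simp add: klein_denom_def)
      from eq have "((1 + s\<^sup>2) * X - 2 * s)\<^sup>2 + ((1 - s\<^sup>2) * Y)\<^sup>2 = 0"
        unfolding 0 by (simp only: zero_power2 mult_eq_0_iff) simp
      then have "(1 + s\<^sup>2) * X - 2 * s = 0" by (simp only: sum_power2_eq_zero_iff)
      with 0 have "(1 - s\<^sup>2)\<^sup>2 = 0" by algebra
      then show False using assms by (simp add: abs_square_eq_1)
    qed
    then have "klein s (klein (- s) W) = W" using klein_inverse(1)[of "- s" W] assms W by simp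
    moreover have "norm (klein (- s) W) = 1/2"
      using klein_inner_circle_equation[OF assms d] eq W by simp
    ultimately show "W \<in> klein s ` sphere 0 (1/2)" by (metis image_eqI mem_sphere_0)
  qed
qed

lemma affine_image_ellipse:
  "(\<lambda>z. n + m * z) ` ellipse c \<theta> a b = ellipse (n + m * c) (\<theta> + Arg m) (norm m * a) (norm m * b)"
  if "m \<noteq> 0"
proof -
  have m: "m * (c + cis \<theta> * Complex x y) = m * c + cis (\<theta> + Arg m) * Complex (norm m * x) (norm m * y)" for x y
  proof -
    have "m = norm m * cis (Arg m)" using that by (simp add: cis_Arg sgn_div_norm scaleR_conv_of_real)
    moreover have "Complex (norm m * x) (norm m * y) = norm m * Complex x y" by (simp add: complex_eq_iff)
    ultimately show ?thesis by (simp add: cis_mult[symmetric] algebra_simps)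
  qed
  show ?thesis
  proof (intro equalityI subsetI)
    fix X assume "X \<in> (\<lambda>z. n + m * z) ` ellipse c \<theta> a b"
    then obtain x y where "X = n + m * (c + cis \<theta> * Complex x y)" "(x / a)\<^sup>2 + (y / b)\<^sup>2 = 1"
      by (auto simp: ellipse_def)
    then show "X \<in> ellipse (n + m * c) (\<theta> + Arg m) (norm m * a) (norm m * b)"
      unfolding ellipse_def m using that
      by (intro CollectI exI[of _ "norm m * x"] exI[of _ "norm m * y"]) simp
  next
    fix X assume "X \<in> ellipse (n + m * c) (\<theta> + Arg m) (norm m * a) (norm m * b)"
    then obtain x y where X: "X = n + m * c + cis (\<theta> + Arg m) * Complex x y"
      and xy: "(x / (norm m * a))\<^sup>2 + (y / (norm m * b))\<^sup>2 = 1" by (auto simp: ellipse_def)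
    have "c + cis \<theta> * Complex (x / norm m) (y / norm m) \<in> ellipse c \<theta> a b"
      using xy unfolding ellipse_def by auto
    moreover have "X = n + m * (c + cis \<theta> * Complex (x / norm m) (y / norm m))"
      unfolding m using that by (simp add: X)
    ultimately show "X \<in> (\<lambda>z. n + m * z) ` ellipse c \<theta> a b" by blast
  qed
qed

lemma brocard_map_inner_circle:
  assumes "\<bar>s\<bar> < 1" "m \<noteq> 0"
  shows "brocard_map s m n ` sphere 0 (1/2) =
    ellipse (n + m * of_real (klein_centre s)) (Arg m) (norm m * klein_major s) (norm m * klein_minor s)"
proof -
  have "brocard_map s m n ` sphere 0 (1/2) = (\<lambda>z. n + m * z) ` klein s ` sphere 0 (1/2)"
    by (simp add: image_image brocard_map_def)
  then show ?thesis by (simp add: klein_inner_circle assms affine_image_ellipse)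
qed

text \<open>The Fourier coefficient \<open>\<alpha>\<close> of the image under \<open>klein s\<close> of the equilateral triangle with
vertex \<open>u\<close>; the coefficient \<open>p\<close> is \<open>moebius_centroid\<close>.\<close>

definition moebius_scale :: "real \<Rightarrow> complex \<Rightarrow> complex" where
  "moebius_scale s u = of_real (1 - s\<^sup>2) * u / (1 + (of_real s * u)^3)"
definition moebius_centroid :: "real \<Rightarrow> complex \<Rightarrow> complex" where
  "moebius_centroid s u = (of_real s + (of_real s)\<^sup>2 * u^3) / (1 + (of_real s * u)^3)"

lemma one_plus_cube_ne0:
  fixes u :: complex
  assumes "norm u = 1" "\<bar>s\<bar> < 1" shows "1 + (of_real s * u)^3 \<noteq> 0"
proof
  assume "1 + (of_real s * u)^3 = 0"
  then have "(of_real s * u)^3 = - 1" by (simp only: add_eq_0_iff)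
  then have "norm ((of_real s * u)^3) = norm (- 1 :: complex)" by (rule arg_cong)
  then have "norm ((of_real s * u)^3) = 1" by simp
  then have "norm (of_real s * u) ^ 3 = 1" by (simp only: norm_power)
  moreover have "norm (of_real s * u) = \<bar>s\<bar>" using assms by (simp add: norm_mult)
  moreover have "\<bar>s\<bar> ^ 3 < 1" using assms(2) by (simp add: power_less_one_iff)
  ultimately show False by simp
qed

text \<open>Expanding \<open>(w + s) / (1 + s w)\<close> in powers of \<open>w\<close> and collecting exponents modulo 3 uses only
\<open>w\<^sup>3 = u\<^sup>3\<close>: the geometric series sums to the denominator \<open>1 + (s u)\<^sup>3\<close> and three terms remain. The
ratio of the last two is \<open>- s u\<close>.\<close>

lemma klein_fourier:
  assumes "norm w = 1" "\<bar>s\<bar> < 1" "w^3 = u^3" "norm u = 1"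
  shows "klein s w = moebius_centroid s u + moebius_scale s u * (w / u)
    + (- of_real s * u) * moebius_scale s u * (w / u)\<^sup>2"
proof -
  define \<sigma> where "\<sigma> = complex_of_real s"
  define N where "N = 1 + (\<sigma> * u)^3"
  have N: "N \<noteq> 0" using one_plus_cube_ne0[OF assms(4,2)] by (simp add: N_def \<sigma>_def)
  have u: "u \<noteq> 0" using assms by auto
  have d: "1 + \<sigma> * w \<noteq> 0" using klein_on_circle(3)[OF assms(1,2)] by (simp add: \<sigma>_def)
  have "(w + \<sigma>) * N = (\<sigma> + \<sigma>\<^sup>2 * u^3 + (1 - \<sigma>\<^sup>2) * w - \<sigma> * (1 - \<sigma>\<^sup>2) * w\<^sup>2) * (1 + \<sigma> * w)"
    unfolding N_def using assms(3) by algebra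
  then have "klein s w = (\<sigma> + \<sigma>\<^sup>2 * u^3 + (1 - \<sigma>\<^sup>2) * w - \<sigma> * (1 - \<sigma>\<^sup>2) * w\<^sup>2) / N"
    using N d klein_on_circle(1)[OF assms(1,2)] by (simp add: \<sigma>_def frac_eq_eq)
  also have "\<dots> = (\<sigma> + \<sigma>\<^sup>2 * u^3) / N + (1 - \<sigma>\<^sup>2) * u / N * (w / u) + (- \<sigma> * u) * ((1 - \<sigma>\<^sup>2) * u / N) * (w / u)\<^sup>2"
    using u N by (simp add: field_simps power2_eq_square)
  finally show ?thesis by (simp add: moebius_centroid_def moebius_scale_def N_def \<sigma>_def)
qed

lemma moebius_scale_ne0: "norm u = 1 \<Longrightarrow> \<bar>s\<bar> < 1 \<Longrightarrow> moebius_scale s u \<noteq> 0"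
  using one_plus_cube_ne0[of u s] by (auto simp: moebius_scale_def abs_square_eq_1 simp flip: of_real_power)

lemma brocard_map_fourier:
  assumes "norm u = 1" "\<bar>s\<bar> < 1" "norm w = 1" "w ^ 3 = 1"
  shows "brocard_map s m n (u * w) = (n + m * moebius_centroid s u) + (m * moebius_scale s u) * w
      + (- of_real s * u) * (m * moebius_scale s u) * w\<^sup>2"
proof -
  have "u \<noteq> 0" using assms by auto
  then have k: "klein s (u * w) = moebius_centroid s u + moebius_scale s u * w
      + (- of_real s * u) * moebius_scale s u * w\<^sup>2"
    using klein_fourier[of "u * w" s u] assms by (simp add: norm_mult power_mult_distrib)
  show ?thesis unfolding brocard_map_def k by (simp add: algebra_simps)
qed

lemma brocard_map_equilateral:
  assumes "norm u = 1" "\<bar>s\<bar> < 1"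
  shows "brocard_map s m n ` equilateral u =
    fourier_triangle (n + m * moebius_centroid s u) (m * moebius_scale s u) ((- of_real s * u) * (m * moebius_scale s u))"
proof -
  have w2: "(\<omega>\<^sup>2)\<^sup>2 = \<omega>" "(\<omega>\<^sup>2)^3 = 1" "norm (\<omega>\<^sup>2) = 1"
    using omega_facts(3) by (algebra, algebra, simp add: norm_power omega_facts(1))
  show ?thesis
    using brocard_map_fourier[OF assms, of 1 m n] brocard_map_fourier[OF assms omega_facts(1,3), of m n]
      brocard_map_fourier[OF assms w2(3,2), of m n]
    unfolding w2(1) by (simp add: equilateral_def fourier_triangle_def)
qed

text \<open>The image of the equilateral triangle of \<open>u\<close> has quotient \<open>- s u\<close>, which runs through the
whole circle of radius \<open>s\<close>.\<close>

lemma all_shapes_brocard_map: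
  assumes "0 \<le> s" "s < 1" "m \<noteq> 0"
  shows "all_shapes s (three_periodics (brocard_map s m n ` sphere 0 1, brocard_map s m n ` sphere 0 (1/2)))"
proof -
  have s: "\<bar>s\<bar> < 1" using assms by simp
  have per: "three_periodics (brocard_map s m n ` sphere 0 1, brocard_map s m n ` sphere 0 (1/2))
      = (\<lambda>u. brocard_map s m n ` equilateral u) ` sphere 0 1"
    using collineation_three_periodics[OF brocard_map_collineation[OF s assms(3)], of "sphere 0 (1/2)", OF half_sphere_in_disc]
    by (simp add: concentric_three_periodics image_image)
  have ne: "m * moebius_scale s u \<noteq> 0" if "norm u = 1" for u
    using moebius_scale_ne0[OF that s] assms by simp
  show ?thesis
    unfolding all_shapes_def per
  proof (intro conjI ballI allI impI)
    fix T assume "T \<in> (\<lambda>u. brocard_map s m n ` equilateral u) ` sphere 0 1"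
    then obtain u where u: "norm u = 1" "T = brocard_map s m n ` equilateral u" by auto
    then show "\<exists>p \<alpha> \<zeta>. \<alpha> \<noteq> 0 \<and> cmod \<zeta> = 1 \<and> T = fourier_triangle p \<alpha> (complex_of_real s * \<zeta> * \<alpha>)"
      using brocard_map_equilateral[OF u(1) s, of m n] ne[OF u(1)]
      by (intro exI[of _ "n + m * moebius_centroid s u"] exI[of _ "m * moebius_scale s u"] exI[of _ "- u"]) simp
  next
    fix \<zeta> :: complex assume "norm \<zeta> = 1"
    then have u: "norm (- \<zeta>) = 1" by simp
    show "\<exists>p \<alpha>. \<alpha> \<noteq> 0 \<and> fourier_triangle p \<alpha> (complex_of_real s * \<zeta> * \<alpha>) \<in> (\<lambda>u. brocard_map s m n ` equilateral u) ` sphere 0 1"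
      using brocard_map_equilateral[OF u s, of m n] ne[OF u] u
      by (intro exI[of _ "n + m * moebius_centroid s (- \<zeta>)"] exI[of _ "m * moebius_scale s (- \<zeta>)"] conjI
          image_eqI[of _ _ "- \<zeta>"]) simp_all
  qed
qed

section \<open>Ellipses touching the sides of a triangle\<close>

lemma barycentric_coordinates:
  fixes A B C X :: complex
  assumes "\<not> collinear {A, B, C}"
  obtains x y z where "x + y + z = 1" "X = x *\<^sub>R A + y *\<^sub>R B + z *\<^sub>R C"
proof -
  define P Q W where "P = B - A" and "Q = C - A" and "W = X - A"
  define d where "d = Re P * Im Q - Im P * Re Q"
  have d: "d \<noteq> 0" using assms by (simp add: collinear_cross d_def P_def Q_def)
  \<comment> \<open>Cramer's rule.\<close>
  define y where "y = (Re W * Im Q - Im W * Re Q) / d"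
  define z where "z = (Re P * Im W - Im P * Re W) / d"
  have "y * Re P + z * Re Q = Re W" "y * Im P + z * Im Q = Im W"
    using d by (simp_all add: y_def z_def field_simps) (simp_all add: d_def algebra_simps)
  then have "W = y *\<^sub>R P + z *\<^sub>R Q" by (simp add: complex_eq_iff)
  then have "X = (1 - y - z) *\<^sub>R A + y *\<^sub>R B + z *\<^sub>R C"
    by (simp add: P_def Q_def W_def algebra_simps)
  then show ?thesis using that[of "1 - y - z" y z] by simp
qed

text \<open>The point dividing the segment with masses \<open>q\<close> at \<open>P\<close> and \<open>r\<close> at \<open>Q\<close>; positive masses for all
three vertices describe the feet of three concurrent cevians.\<close>

definition section_point :: "real \<Rightarrow> real \<Rightarrow> complex \<Rightarrow> complex \<Rightarrow> complex" where
  "section_point q r P Q = (q *\<^sub>R P + r *\<^sub>R Q) /\<^sub>R (q + r)"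

lemma section_point_convex:
  assumes "0 < q" "0 < r"
  shows "section_point q r P Q = (1 - r / (q + r)) *\<^sub>R P + (r / (q + r)) *\<^sub>R Q"
proof -
  have "1 - r / (q + r) = q / (q + r)" using assms by (simp add: field_simps)
  then show ?thesis by (simp add: section_point_def scaleR_add_right divide_inverse mult.commute)
qed

lemma section_point_in_affine_hull: "0 < q \<Longrightarrow> 0 < r \<Longrightarrow> section_point q r P Q \<in> affine hull {P, Q}"
  unfolding section_point_convex affine_hull_2_eq by blast

lemma section_point_scale:
  assumes "h \<noteq> 0"
  shows "section_point (h * q) (h * r) P Q = section_point q r P Q"
proof -
  have "(h * q) *\<^sub>R P + (h * r) *\<^sub>R Q = h *\<^sub>R (q *\<^sub>R P + r *\<^sub>R Q)" by (simp add: scaleR_add_right)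
  then show ?thesis using assms by (simp add: section_point_def distrib_left[symmetric])
qed

text \<open>The quadratic form \<open>X \<bullet> X - 1\<close> restricted to a tangent line is the squared distance to the
point of contact, which fixes its values and its polar form at two points of the line up to one
factor.\<close>

lemma tangent_gram:
  fixes P Q :: complex
  assumes "P \<noteq> Q" "0 < q" "0 < r"
    and touch: "affine hull {P, Q} \<inter> sphere 0 1 = {section_point q r P Q}"
  obtains k where "0 < k" "P \<bullet> P - 1 = r\<^sup>2 * k" "Q \<bullet> Q - 1 = q\<^sup>2 * k" "P \<bullet> Q - 1 = - (q * r * k)"
proof -
  define D v where "D = section_point q r P Q" and "v = Q - P"
  define k where "k = (v \<bullet> v) / (q + r)\<^sup>2"
  have "D \<bullet> v = 0" "norm D = 1"
    using tangent_line_orthogonal[OF assms(1) touch] by (simp_all add: D_def v_def)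
  then have D: "D \<bullet> v = 0" "v \<bullet> D = 0" "D \<bullet> D = 1" by (simp_all add: norm_eq_sqrt_inner inner_commute)
  have D': "D = P + (r / (q + r)) *\<^sub>R v"
    unfolding D_def section_point_convex[OF assms(2,3)] by (simp add: v_def algebra_simps)
  then have P: "P = D - (r / (q + r)) *\<^sub>R v" by simp
  have "(1 - r / (q + r)) = q / (q + r)" using assms by (simp add: field_simps)
  moreover have "Q = D + (1 - r / (q + r)) *\<^sub>R v" unfolding D' by (simp add: v_def algebra_simps)
  ultimately have Q: "Q = D + (q / (q + r)) *\<^sub>R v" by simp
  have "0 < k" using assms by (simp add: k_def v_def)
  moreover have "P \<bullet> P - 1 = r\<^sup>2 * k"
    by (simp add: P k_def inner_diff D power2_eq_square)
  moreover have "Q \<bullet> Q - 1 = q\<^sup>2 * k"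
    by (simp add: Q k_def inner_add D power2_eq_square)
  moreover have "P \<bullet> Q - 1 = - (q * r * k)"
    by (simp add: P Q k_def inner_add inner_diff D power2_eq_square)
  ultimately show ?thesis using that by blast
qed

text \<open>In barycentric coordinates the conic is given by the Gram matrix of the vertices for the
form \<open>X \<bullet> X - 1\<close>. Each side fixes a two-by-two block of it up to a factor (\<open>tangent_gram\<close>), and the
shared diagonal entries tie the three factors together. Hence the equation depends on the points
of contact alone.\<close>

lemma inscribed_circle_barycentric:
  fixes A B C :: complex
  assumes ne: "A \<noteq> B" "B \<noteq> C" "C \<noteq> A" and pos: "0 < p" "0 < q" "0 < r"
    and BC: "affine hull {B, C} \<inter> sphere 0 1 = {section_point q r B C}"
    and CA: "affine hull {C, A} \<inter> sphere 0 1 = {section_point r p C A}"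
    and AB: "affine hull {A, B} \<inter> sphere 0 1 = {section_point p q A B}"
    and xyz: "x + y + z = 1"
  shows "norm (x *\<^sub>R A + y *\<^sub>R B + z *\<^sub>R C) = 1 \<longleftrightarrow>
    (q * r * x)\<^sup>2 + (r * p * y)\<^sup>2 + (p * q * z)\<^sup>2
      = 2 * p * q * r * (r * x * y + p * y * z + q * z * x)"
proof -
  obtain k1 where k1: "0 < k1" "B \<bullet> B - 1 = r\<^sup>2 * k1" "C \<bullet> C - 1 = q\<^sup>2 * k1" "B \<bullet> C - 1 = - (q * r * k1)"
    using tangent_gram[OF ne(2) pos(2,3) BC] .
  obtain k2 where k2: "0 < k2" "C \<bullet> C - 1 = p\<^sup>2 * k2" "A \<bullet> A - 1 = r\<^sup>2 * k2" "C \<bullet> A - 1 = - (r * p * k2)"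
    using tangent_gram[OF ne(3) pos(3,1) CA] .
  obtain k3 where k3: "0 < k3" "A \<bullet> A - 1 = q\<^sup>2 * k3" "B \<bullet> B - 1 = p\<^sup>2 * k3" "A \<bullet> B - 1 = - (p * q * k3)"
    using tangent_gram[OF ne(1) pos(1,2) AB] .
  \<comment> \<open>The three factors are \<open>p\<^sup>2\<close>, \<open>q\<^sup>2\<close>, \<open>r\<^sup>2\<close> times one common factor \<open>l\<close>.\<close>
  define l where "l = k1 / p\<^sup>2"
  have l: "0 < l" using k1 pos by (simp add: l_def)
  have e1: "k1 = p\<^sup>2 * l" using pos by (simp add: l_def)
  have "p\<^sup>2 * k2 = p\<^sup>2 * (q\<^sup>2 * l)" using k1(3) k2(2) by (simp add: e1)
  then have e2: "k2 = q\<^sup>2 * l" using pos by simp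
  have "p\<^sup>2 * k3 = p\<^sup>2 * (r\<^sup>2 * l)" using k1(2) k3(3) by (simp add: e1)
  then have e3: "k3 = r\<^sup>2 * l" using pos by simp
  define X where "X = x *\<^sub>R A + y *\<^sub>R B + z *\<^sub>R C"
  have "X \<bullet> X - (x + y + z)\<^sup>2 = x\<^sup>2 * (A \<bullet> A - 1) + y\<^sup>2 * (B \<bullet> B - 1) + z\<^sup>2 * (C \<bullet> C - 1)
      + 2 * x * y * (A \<bullet> B - 1) + 2 * y * z * (B \<bullet> C - 1) + 2 * z * x * (C \<bullet> A - 1)"
    by (simp add: X_def inner_add inner_commute[of B A] inner_commute[of C B] inner_commute[of A C]
        power2_eq_square algebra_simps)
  also have "\<dots> = l * ((q * r * x)\<^sup>2 + (r * p * y)\<^sup>2 + (p * q * z)\<^sup>2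
      - 2 * p * q * r * (r * x * y + p * y * z + q * z * x))"
    unfolding k1(2,4) k2(2-4) k3(4) e1 e2 e3 by (simp add: power2_eq_square algebra_simps)
  finally have "X \<bullet> X - 1 = l * ((q * r * x)\<^sup>2 + (r * p * y)\<^sup>2 + (p * q * z)\<^sup>2
      - 2 * p * q * r * (r * x * y + p * y * z + q * z * x))" by (simp add: xyz)
  moreover have "norm X = 1 \<longleftrightarrow> X \<bullet> X - 1 = 0" by (simp add: norm_eq_sqrt_inner)
  ultimately show ?thesis using l unfolding X_def[symmetric] by simp
qed

text \<open>Barycentric coordinates, division ratios and tangency are affinely invariant, so the circular
case suffices.\<close>

lemma inscribed_ellipse_barycentric:
  fixes A B C :: complex
  assumes E: "E = ellipse c \<theta> a b" "0 < a" "0 < b"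
    and ne: "A \<noteq> B" "B \<noteq> C" "C \<noteq> A" and pos: "0 < p" "0 < q" "0 < r"
    and BC: "affine hull {B, C} \<inter> E = {section_point q r B C}"
    and CA: "affine hull {C, A} \<inter> E = {section_point r p C A}"
    and AB: "affine hull {A, B} \<inter> E = {section_point p q A B}"
    and xyz: "x + y + z = 1"
  shows "x *\<^sub>R A + y *\<^sub>R B + z *\<^sub>R C \<in> E \<longleftrightarrow>
    (q * r * x)\<^sup>2 + (r * p * y)\<^sup>2 + (p * q * z)\<^sup>2
      = 2 * p * q * r * (r * x * y + p * y * z + q * z * x)"
proof -
  define \<alpha> \<beta> where "\<alpha> = cis \<theta> * complex_of_real ((a + b) / 2)" and "\<beta> = cis \<theta> * complex_of_real ((a - b) / 2)"
  define G where "G = real_affine_map c \<alpha> \<beta>"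
  have "norm \<alpha> = (a + b) / 2" "norm \<beta> = \<bar>a - b\<bar> / 2"
    using E(2,3) unfolding \<alpha>_def \<beta>_def by (simp_all only: norm_mult norm_cis norm_of_real) auto
  then have less: "norm \<beta> < norm \<alpha>" using E(2,3) by simp
  have bij: "bij G" unfolding G_def using real_affine_map_bij[OF less] .
  have EG: "E = G ` sphere 0 1"
    using ellipse_affine_image[OF E(2,3), of 1 c \<theta>] by (simp add: E(1) G_def \<alpha>_def \<beta>_def)
  obtain A' B' C' where G: "A = G A'" "B = G B'" "C = G C'" using bij by (metis bij_pointE)
  have aff: "G ((1 - t) *\<^sub>R P + t *\<^sub>R Q) = (1 - t) *\<^sub>R G P + t *\<^sub>R G Q" for t P Q
    using real_affine_map_affine[of "1 - t" t 0 c \<alpha> \<beta> P Q 0] by (simp add: G_def)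
  have hull: "affine hull {G P, G Q} = G ` (affine hull {P, Q})" for P Q
    unfolding affine_hull_2_eq by (force simp: aff)
  have sect: "section_point e f (G P) (G Q) = G (section_point e f P Q)" if "0 < e" "0 < f" for e f P Q
    by (simp only: section_point_convex[OF that] aff)
  have pull: "affine hull {P, Q} \<inter> sphere 0 1 = {section_point e f P Q}"
    if "affine hull {G P, G Q} \<inter> E = {section_point e f (G P) (G Q)}" "0 < e" "0 < f" for e f P Q
  proof -
    have "G ` (affine hull {P, Q} \<inter> sphere 0 1) = G ` {section_point e f P Q}"
      using that bij unfolding hull EG sect[OF that(2,3)] by (simp add: image_Int bij_def)
    then show ?thesis using bij by (simp only: inj_image_eq_iff bij_def)
  qed
  have "x *\<^sub>R A + y *\<^sub>R B + z *\<^sub>R C = G (x *\<^sub>R A' + y *\<^sub>R B' + z *\<^sub>R C')"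
    unfolding G using real_affine_map_affine[OF xyz] by (simp add: G_def)
  then have "x *\<^sub>R A + y *\<^sub>R B + z *\<^sub>R C \<in> E \<longleftrightarrow> norm (x *\<^sub>R A' + y *\<^sub>R B' + z *\<^sub>R C') = 1"
    using bij unfolding EG by (simp add: inj_image_mem_iff bij_def)
  also have "\<dots> \<longleftrightarrow> (q * r * x)\<^sup>2 + (r * p * y)\<^sup>2 + (p * q * z)\<^sup>2
      = 2 * p * q * r * (r * x * y + p * y * z + q * z * x)"
    using ne BC CA AB pos unfolding G
    by (intro inscribed_circle_barycentric pull xyz) auto
  finally show ?thesis .
qed

section \<open>Symmedians and the Brocard inellipse\<close>

text \<open>Reflecting in the bisector exchanges the directions of the two edges at \<open>A\<close> but keeps the
lengths. The reflected median thus has direction \<open>\<bar>Q\<bar> e + \<bar>P\<bar> f\<close> for edge vectors \<open>P\<close>, \<open>Q\<close> with unit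
vectors \<open>e\<close>, \<open>f\<close>, that is \<open>\<bar>Q\<bar>\<^sup>2 P + \<bar>P\<bar>\<^sup>2 Q\<close> up to scaling, and it divides the opposite side in
the ratio of the squares of the adjacent sides.\<close>

lemma symmedian_meets_side:
  assumes nc: "\<not> collinear {A, B, C}"
  shows "symmedian A B C \<inter> affine hull {B, C} = {section_point ((dist C A)\<^sup>2) ((dist A B)\<^sup>2) B C}"
proof -
  define P Q where "P = B - A" and "Q = C - A"
  define S where "S = reflect_line A (sgn (B - A) + sgn (C - A)) (midpoint B C)"
  define e f where "e = sgn P" and "f = sgn Q"
  define g where "g = e \<bullet> f"
  define F where "F = section_point ((dist C A)\<^sup>2) ((dist A B)\<^sup>2) B C"
  have P0: "P \<noteq> 0" and Q0: "Q \<noteq> 0" using nc unfolding collinear_cross P_def Q_def by auto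
  have Pe: "P = norm P *\<^sub>R e" and Qf: "Q = norm Q *\<^sub>R f" using P0 Q0 by (simp_all add: e_def f_def sgn_div_norm)
  have "norm e = 1" "norm f = 1" using P0 Q0 by (simp_all add: e_def f_def norm_sgn)
  then have unit: "e \<bullet> e = 1" "f \<bullet> f = 1" by (simp_all add: norm_eq_sqrt_inner)
  have uu: "(e + f) \<bullet> (e + f) = 2 * (1 + g)"
    using unit by (simp add: inner_add inner_commute[of f e] g_def)
  \<comment> \<open>The two edges at \<open>A\<close> do not point in opposite directions, so the bisector has a direction.\<close>
  have g: "1 + g \<noteq> 0"
  proof
    assume "1 + g = 0"
    then have "e + f = 0" using uu by simp
    then have "f = - e" by (simp add: eq_neg_iff_add_eq_0 add.commute)
    moreover obtain x where "P = x *\<^sub>R e" using Pe by blast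
    moreover obtain y where "Q = y *\<^sub>R f" using Qf by blast
    ultimately have "collinear {A, B, C}"
      unfolding collinear_cross P_def[symmetric] Q_def[symmetric] by simp
    with nc show False by simp
  qed
  have mid: "midpoint B C - A = (1/2) *\<^sub>R (norm P *\<^sub>R e + norm Q *\<^sub>R f)"
    unfolding Pe[symmetric] Qf[symmetric] by (simp add: P_def Q_def midpoint_def complex_eq_iff)
  have "(midpoint B C - A) \<bullet> (e + f) = (1 + g) * ((norm P + norm Q) / 2)"
    unfolding mid using unit by (simp add: inner_add inner_commute[of f e] g_def algebra_simps add_divide_distrib)
  then have "2 * ((midpoint B C - A) \<bullet> (e + f)) / ((e + f) \<bullet> (e + f)) = (norm P + norm Q) / 2"
    unfolding uu by (simp only:)
      (subst mult_divide_mult_cancel_left, simp, rule nonzero_mult_div_cancel_left[OF g])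
  then have "S = A + ((norm P + norm Q) / 2) *\<^sub>R (e + f) - (1/2) *\<^sub>R (norm P *\<^sub>R e + norm Q *\<^sub>R f)"
    unfolding S_def reflect_line_def P_def[symmetric] Q_def[symmetric] e_def[symmetric] f_def[symmetric]
    by (simp only: mid)
  then have S: "S = A + (1/2) *\<^sub>R (norm Q *\<^sub>R e + norm P *\<^sub>R f)"
    by (simp add: complex_eq_iff field_simps)
  define N where "N = (norm Q)\<^sup>2 + (norm P)\<^sup>2"
  define V where "V = norm Q *\<^sub>R e + norm P *\<^sub>R f"
  define k where "k = 2 * (norm P * norm Q / N)"
  have N: "N \<noteq> 0" using P0 by (simp add: N_def sum_power2_eq_zero_iff)
  have dists: "dist C A = norm Q" "dist A B = norm P" by (simp_all add: P_def Q_def dist_norm norm_minus_commute)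
  have BC: "B = A + norm P *\<^sub>R e" "C = A + norm Q *\<^sub>R f" using Pe Qf by (simp_all add: P_def Q_def)
  have "(norm Q)\<^sup>2 *\<^sub>R B + (norm P)\<^sup>2 *\<^sub>R C = N *\<^sub>R A + (norm P * norm Q) *\<^sub>R V"
    unfolding BC N_def V_def by (simp add: algebra_simps power2_eq_square)
  then have "F = A + (norm P * norm Q / N) *\<^sub>R V"
    unfolding F_def section_point_def dists N_def[symmetric] using N
    by (simp add: scaleR_add_right divide_inverse mult.commute)
  also have "\<dots> = (1 - k) *\<^sub>R A + k *\<^sub>R S"
    unfolding S V_def[symmetric] k_def by (simp add: algebra_simps)
  finally have FS: "F = (1 - k) *\<^sub>R A + k *\<^sub>R S" .
  have F1: "F \<in> symmedian A B C" unfolding symmedian_def S_def[symmetric] affine_hull_2_eq using FS by blast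
  have F2: "F \<in> affine hull {B, C}" unfolding F_def using P0 Q0 dists by (intro section_point_in_affine_hull) simp_all
  have "X = F" if X: "X \<in> symmedian A B C" "X \<in> affine hull {B, C}" for X
  proof (rule ccontr)
    assume "X \<noteq> F"
    have "collinear (affine hull {A, S})" "collinear (affine hull {B, C})"
      by (simp_all add: collinear_affine_hull_collinear)
    moreover have "{X, F, A} \<subseteq> affine hull {A, S}"
      using X F1 by (simp add: symmedian_def S_def hull_inc)
    moreover have "{X, F, B} \<subseteq> affine hull {B, C}" "{X, F, C} \<subseteq> affine hull {B, C}"
      using X F2 by (simp_all add: hull_inc)
    ultimately have "collinear {X, F, A}" "collinear {X, F, B}" "collinear {X, F, C}"
      by (meson collinear_subset)+
    then have "collinear {X, F, A, B, C}"
      using collinear_triples[OF \<open>X \<noteq> F\<close>, of "{A, B, C}"] by simp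
    then have "collinear {A, B, C}" by (rule collinear_subset) auto
    with nc show False by simp
  qed
  then show ?thesis using F1 F2 unfolding F_def[symmetric] by blast
qed

lemma brocard_inellipse_contacts:
  assumes nc: "\<not> collinear {A, B, C}" and E: "brocard_inellipse A B C E"
  shows "affine hull {B, C} \<inter> E = {section_point ((dist C A)\<^sup>2) ((dist A B)\<^sup>2) B C}"
    "affine hull {C, A} \<inter> E = {section_point ((dist A B)\<^sup>2) ((dist B C)\<^sup>2) C A}"
    "affine hull {A, B} \<inter> E = {section_point ((dist B C)\<^sup>2) ((dist C A)\<^sup>2) A B}"
proof -
  have contact: "affine hull {Q, R} \<inter> E = {section_point ((dist R P)\<^sup>2) ((dist P Q)\<^sup>2) Q R}"
    if "\<not> collinear {P, Q, R}" "\<exists>D\<in>symmedian P Q R. side_tangent_at Q R D E" for P Q R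
  proof -
    from that(2) obtain D where D: "D \<in> symmedian P Q R" "affine hull {Q, R} \<inter> E = {D}"
      unfolding side_tangent_at_def by blast
    then have "D \<in> symmedian P Q R \<inter> affine hull {Q, R}" by blast
    then show ?thesis unfolding symmedian_meets_side[OF that(1)] using D(2) by simp
  qed
  have rot: "{B, C, A} = {A, B, C}" "{C, A, B} = {A, B, C}" by auto
  show "affine hull {B, C} \<inter> E = {section_point ((dist C A)\<^sup>2) ((dist A B)\<^sup>2) B C}"
    "affine hull {C, A} \<inter> E = {section_point ((dist A B)\<^sup>2) ((dist B C)\<^sup>2) C A}"
    "affine hull {A, B} \<inter> E = {section_point ((dist B C)\<^sup>2) ((dist C A)\<^sup>2) A B}"
    using E nc unfolding brocard_inellipse_def by (intro contact; simp add: rot)+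
qed

text \<open>Both ellipses have the same points of contact, hence the same barycentric equation.\<close>

lemma brocard_inellipse_unique:
  assumes nc: "\<not> collinear {A, B, C}" and "brocard_inellipse A B C E" "brocard_inellipse A B C E'"
  shows "E = E'"
proof -
  have ne: "A \<noteq> B" "B \<noteq> C" "C \<noteq> A" using nc unfolding collinear_cross by auto
  define p q r where "p = (dist B C)\<^sup>2" and "q = (dist C A)\<^sup>2" and "r = (dist A B)\<^sup>2"
  have pos: "0 < p" "0 < q" "0 < r" using ne by (simp_all add: p_def q_def r_def)
  have eqn: "x *\<^sub>R A + y *\<^sub>R B + z *\<^sub>R C \<in> D \<longleftrightarrow>
    (q * r * x)\<^sup>2 + (r * p * y)\<^sup>2 + (p * q * z)\<^sup>2
      = 2 * p * q * r * (r * x * y + p * y * z + q * z * x)"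
    if D: "brocard_inellipse A B C D" and xyz: "x + y + z = 1" for D x y z
  proof -
    from D obtain c \<theta> a b where "0 < a" "0 < b" "D = ellipse c \<theta> a b"
      unfolding brocard_inellipse_def by blast
    then show ?thesis
      using inscribed_ellipse_barycentric[OF _ _ _ ne pos _ _ _ xyz]
        brocard_inellipse_contacts[OF nc D] unfolding p_def q_def r_def by blast
  qed
  have "X \<in> E \<longleftrightarrow> X \<in> E'" for X
  proof -
    obtain x y z where "x + y + z = 1" "X = x *\<^sub>R A + y *\<^sub>R B + z *\<^sub>R C"
      using barycentric_coordinates[OF nc] .
    then show ?thesis using eqn assms(2,3) by simp
  qed
  then show ?thesis by blast
qed

section \<open>Brocard porisms\<close>

text \<open>The map sends the midpoint of a side to the point dividing the image side with masses equal to
the denominators at the endpoints. By the chord formula the squared sides of the image triangle are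
inversely proportional to products of these denominators, so the same point has the masses required
by \<open>symmedian_meets_side\<close>.\<close>

lemma brocard_map_symmedian_foot:
  assumes s: "\<bar>s\<bar> < 1" "m \<noteq> 0" and u: "norm u = 1"
    and w: "w0 \<in> equilateral u" "w1 \<in> equilateral u" "w2 \<in> equilateral u" "w0 \<noteq> w1" "w1 \<noteq> w2" "w2 \<noteq> w0"
    and nc: "\<not> collinear {brocard_map s m n w0, brocard_map s m n w1, brocard_map s m n w2}"
  shows "brocard_map s m n (midpoint w1 w2)
    \<in> symmedian (brocard_map s m n w0) (brocard_map s m n w1) (brocard_map s m n w2)"
proof -
  let ?K = "brocard_map s m n" and ?d = "klein_denom s"
  have norm: "norm w0 = 1" "norm w1 = 1" "norm w2 = 1"
    using equilateral_vertices[OF u] w by blast+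
  have pos: "0 < ?d w0" "0 < ?d w1" "0 < ?d w2" using klein_denom_pos[OF s(1)] norm by simp_all
  have side: "(norm (a - b))\<^sup>2 = 3" if "a \<in> equilateral u" "b \<in> equilateral u" "a \<noteq> b" for a b
    using equilateral_vertices[OF u that] equilateral_vertices(1)[OF u that(2,1)] that(3)
    by (auto simp: power2_norm_eq_inner inner_diff inner_commute norm_eq_sqrt_inner)
  define k where "k = (norm m)\<^sup>2 * ((1 - s\<^sup>2)\<^sup>2 * 3)"
  have k: "0 < k" using s by (simp add: k_def abs_square_eq_1)
  have dist: "(dist (?K a) (?K b))\<^sup>2 = k / (?d a * ?d b)"
    if "a \<in> equilateral u" "b \<in> equilateral u" "a \<noteq> b" for a b
  proof -
    have "norm a = 1" "norm b = 1" using equilateral_vertices(1)[OF u] that by blast+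
    note klein_chord_length[OF this s(1)]
    moreover have "dist (?K a) (?K b) = norm m * norm (klein s a - klein s b)"
      by (simp add: brocard_map_def dist_norm right_diff_distrib[symmetric] norm_mult)
    ultimately show ?thesis by (simp add: power_mult_distrib side[OF that] k_def)
  qed
  define L where "L z = klein_denom s z *\<^sub>R n + m * (z + 2 * of_real s + (of_real s)\<^sup>2 * cnj z)" for z
  have KL: "?K z = L z /\<^sub>R ?d z" if "norm z \<le> 1" for z
    using brocard_map_projective[OF s(1) that] by (simp add: L_def)
  from midpoint_in_disc[OF norm(2,3)] have mid: "?K (midpoint w1 w2) = L (midpoint w1 w2) /\<^sub>R ?d (midpoint w1 w2)" by (simp add: KL)
  have d2: "?d (midpoint w1 w2) = (1/2) * (?d w1 + ?d w2)"
    by (simp add: klein_denom_def midpoint_def field_simps)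
  have L2: "L (midpoint w1 w2) = (1/2) *\<^sub>R (L w1 + L w2)"
    unfolding L_def d2 by (simp add: midpoint_def scaleR_conv_of_real field_simps)
  have half: "((1/2) *\<^sub>R V) /\<^sub>R ((1/2) * e) = V /\<^sub>R e" for V :: complex and e
    by (simp add: inverse_eq_divide)
  have "L w1 = ?d w1 *\<^sub>R ?K w1" "L w2 = ?d w2 *\<^sub>R ?K w2"
    using pos by (simp_all add: KL norm)
  then have "?K (midpoint w1 w2) = section_point (?d w1) (?d w2) (?K w1) (?K w2)"
    unfolding mid d2 L2 section_point_def by (simp only: half)
  also have "\<dots> = section_point (k / (?d w2 * ?d w0)) (k / (?d w0 * ?d w1)) (?K w1) (?K w2)"
  proof -
    \<comment> \<open>The factor between the two triples of masses is symmetric in the three vertices.\<close>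
    define h where "h = k / (?d w0 * ?d w1 * ?d w2)"
    have h: "h \<noteq> 0" using k pos by (simp add: h_def)
    have "k / (?d w2 * ?d w0) = h * ?d w1" "k / (?d w0 * ?d w1) = h * ?d w2"
      using pos by (simp_all add: h_def field_simps)
    then show ?thesis using section_point_scale[OF h] by simp
  qed
  finally show ?thesis
    using symmedian_meets_side[OF nc] dist[of w2 w0] dist[of w0 w1] w by auto
qed

lemma equilateral_distinct_eq:
  assumes "norm u = 1" "w0 \<in> equilateral u" "w1 \<in> equilateral u" "w2 \<in> equilateral u" "w0 \<noteq> w1" "w1 \<noteq> w2" "w2 \<noteq> w0"
  shows "{w0, w1, w2} = equilateral u"
  using assms(2-) by (auto simp: equilateral_def)

lemma brocard_map_inellipse:
  assumes s: "\<bar>s\<bar> < 1" "m \<noteq> 0" and u: "norm u = 1"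
    and w: "w0 \<in> equilateral u" "w1 \<in> equilateral u" "w2 \<in> equilateral u" "w0 \<noteq> w1" "w1 \<noteq> w2" "w2 \<noteq> w0"
  shows "triangle {brocard_map s m n w0, brocard_map s m n w1, brocard_map s m n w2}"
    and "brocard_inellipse (brocard_map s m n w0) (brocard_map s m n w1) (brocard_map s m n w2)
      (brocard_map s m n ` sphere 0 (1/2))"
proof -
  let ?K = "brocard_map s m n"
  note K = brocard_map_collineation[OF s]
  have norm: "norm w0 = 1" "norm w1 = 1" "norm w2 = 1"
    using equilateral_vertices[OF u] w by blast+
  have "triangle {w0, w1, w2}" using equilateral_triangle[OF u] equilateral_distinct_eq[OF u w] by simp
  then have "triangle (?K ` {w0, w1, w2})"
    using collineation_triangle[OF K, of "{w0, w1, w2}" n] norm by simp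
  then show tri: "triangle {?K w0, ?K w1, ?K w2}" by simp
  then have nc: "\<not> collinear {?K w0, ?K w1, ?K w2}" by (simp add: triangle_def)
  have tang: "side_tangent_at (?K a) (?K b) (?K (midpoint a b)) (?K ` sphere 0 (1/2))"
    if "a \<in> equilateral u" "b \<in> equilateral u" "a \<noteq> b" for a b
  proof -
    have n: "norm a = 1" "norm b = 1" using equilateral_vertices(1)[OF u] that by blast+
    from midpoint_in_disc[OF this] show ?thesis
      using collineation_side_tangent[OF K n[THEN eq_refl] that(3) half_sphere_in_disc] chord_side_tangent_iff[OF n that(3)]
        equilateral_vertices(2)[OF u that] by simp
  qed
  have rot: "{b, c, a} = {a, b, c}" "{c, a, b} = {a, b, c}" for a b c :: complex by auto
  have "\<exists>c \<theta> a b. 0 < a \<and> 0 < b \<and> ?K ` sphere 0 (1/2) = ellipse c \<theta> a b"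
    using brocard_map_inner_circle[OF s] klein_axes_pos[OF s(1)] s(2) by (metis mult_pos_pos zero_less_norm_iff)
  moreover have "?K (midpoint w1 w2) \<in> symmedian (?K w0) (?K w1) (?K w2)"
    using brocard_map_symmedian_foot[OF s u w nc] .
  moreover have "?K (midpoint w2 w0) \<in> symmedian (?K w1) (?K w2) (?K w0)"
    using brocard_map_symmedian_foot[OF s u w(2,3,1,5,6,4)] nc by (simp add: rot)
  moreover have "?K (midpoint w0 w1) \<in> symmedian (?K w2) (?K w0) (?K w1)"
    using brocard_map_symmedian_foot[OF s u w(3,1,2,6,4,5)] nc by (simp add: rot)
  ultimately show "brocard_inellipse (?K w0) (?K w1) (?K w2) (?K ` sphere 0 (1/2))"
    unfolding brocard_inellipse_def using tang w by blast
qed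

lemma brocard_map_porism:
  assumes "\<bar>s\<bar> < 1" "m \<noteq> 0"
  shows "brocard_porism (brocard_map s m n ` sphere 0 1, brocard_map s m n ` sphere 0 (1/2))"
proof -
  let ?K = "brocard_map s m n"
  have w: "1 \<in> equilateral 1" "\<omega> \<in> equilateral 1" "\<omega>\<^sup>2 \<in> equilateral 1" by (simp_all add: equilateral_def)
  have "norm (1::complex) = 1" by simp
  note E = brocard_map_inellipse[OF assms this w omega_facts(5)[symmetric] omega_facts(7)[symmetric] omega_facts(6), of n]
  have "{?K 1, ?K \<omega>, ?K (\<omega>\<^sup>2)} \<subseteq> ?K ` sphere 0 1" using omega_facts(1) by (auto simp: norm_power)
  then show ?thesis
    unfolding brocard_porism_def using E brocard_map_circle[OF assms, of n] assms(2)
    by (intro exI[of _ "?K 1"] exI[of _ "?K \<omega>"] exI[of _ "?K (\<omega>\<^sup>2)"] exI[of _ n] exI[of _ "norm m"]) simp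
qed

text \<open>The difference of the two circle equations is linear, so its gradient would be orthogonal to
two independent edges.\<close>

lemma circle_through_triangle_unique:
  fixes A B C :: complex
  assumes nc: "\<not> collinear {A, B, C}"
    and 1: "{A, B, C} \<subseteq> sphere z R" and 2: "{A, B, C} \<subseteq> sphere n r"
  shows "z = n" "R = r"
proof -
  define v where "v = n - z"
  have eq: "2 * (X \<bullet> v) = R\<^sup>2 - r\<^sup>2 + n \<bullet> n - z \<bullet> z" if "X \<in> {A, B, C}" for X
  proof -
    have "norm (X - z) = R" "norm (X - n) = r" using 1 2 that by (auto simp: dist_norm norm_minus_commute)
    then have "(X - z) \<bullet> (X - z) = R\<^sup>2" "(X - n) \<bullet> (X - n) = r\<^sup>2" by (simp_all add: power2_norm_eq_inner[symmetric])
    then show ?thesis by (simp add: v_def inner_diff inner_commute algebra_simps)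
  qed
  have "(B - A) \<bullet> v = 0" "(C - A) \<bullet> v = 0"
    using eq[of A] eq[of B] eq[of C] by (simp_all add: inner_diff_left)
  then have orth: "Re (B - A) * Re v + Im (B - A) * Im v = 0" "Re (C - A) * Re v + Im (C - A) * Im v = 0"
    by (simp_all only: inner_complex_def)
  define d where "d = Re (B - A) * Im (C - A) - Im (B - A) * Re (C - A)"
  have "d \<noteq> 0" using nc by (simp add: collinear_cross d_def)
  moreover have "d * Re v = 0" "d * Im v = 0" unfolding d_def using orth by algebra+
  ultimately have "Re v = 0" "Im v = 0" by simp_all
  then show "z = n" by (simp add: v_def complex_eq_iff)
  then show "R = r" using 1 2 by auto
qed

text \<open>Choose \<open>s\<close> and \<open>u\<close> with \<open>\<beta> / \<alpha> = - s u\<close>; the image of the equilateral triangle of \<open>u\<close> then has the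
right shape, and \<open>m\<close> and \<open>n\<close> adjust scale, orientation and position.\<close>

lemma triangle_is_brocard_image:
  fixes A B C :: complex
  assumes A: "A = p + \<alpha> + \<beta>" and B: "B = p + \<alpha> * \<omega> + \<beta> * \<omega>\<^sup>2" and C: "C = p + \<alpha> * \<omega>\<^sup>2 + \<beta> * \<omega>"
    and less: "norm \<beta> < norm \<alpha>"
  obtains s m n u where "0 \<le> s" "s < 1" "m \<noteq> 0" "norm u = 1"
    "A = brocard_map s m n u" "B = brocard_map s m n (u * \<omega>)" "C = brocard_map s m n (u * \<omega>\<^sup>2)"
proof -
  have \<alpha>: "\<alpha> \<noteq> 0" using less by auto
  define s where "s = norm (\<beta> / \<alpha>)"
  have s: "0 \<le> s" "s < 1" using less \<alpha> by (simp_all add: s_def norm_divide)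
  then have s': "\<bar>s\<bar> < 1" by simp
  obtain \<xi> where \<xi>: "norm \<xi> = 1" "\<beta> / \<alpha> = of_real s * \<xi>" unfolding s_def by (rule unit_times_norm)
  define u where "u = - \<xi>"
  have u: "norm u = 1" "u \<noteq> 0" using \<xi> by (auto simp: u_def)
  have \<beta>: "\<beta> = (- of_real s * u) * \<alpha>" using \<alpha> \<xi>(2) by (simp add: u_def field_simps)
  \<comment> \<open>\<open>m\<close> matches the first Fourier coefficient and hence both, \<open>n\<close> matches the centroid.\<close>
  define m where "m = \<alpha> / moebius_scale s u"
  define n where "n = p - m * moebius_centroid s u"
  note sc = moebius_scale_ne0[OF u(1) s']
  have m: "m \<noteq> 0" "m * moebius_scale s u = \<alpha>" using \<alpha> sc by (simp_all add: m_def)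
  have map: "brocard_map s m n (u * w) = p + \<alpha> * w + \<beta> * w\<^sup>2" if "norm w = 1" "w ^ 3 = 1" for w
    using brocard_map_fourier[OF u(1) s' that, of m n] by (simp only: m(2) \<beta> n_def diff_add_cancel)
  have "(\<omega>\<^sup>2)\<^sup>2 = \<omega>" "(\<omega>\<^sup>2)^3 = 1" using omega_facts(3) by algebra+
  then show ?thesis
    using map[of 1] map[of \<omega>] map[of "\<omega>\<^sup>2"] omega_facts(1,3) A B C s m(1) u(1)
    by (intro that[of s m u n]) (simp_all add: norm_power)
qed

lemma side_tangent_at_commute: "side_tangent_at A B = side_tangent_at B A"
  by (simp add: fun_eq_iff side_tangent_at_def insert_commute closed_segment_commute)

lemma symmedian_commute: "symmedian A B C = symmedian A C B"
  by (simp add: symmedian_def add.commute midpoint_sym)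

lemma brocard_inellipse_swap:
  assumes "brocard_inellipse A B C E" shows "brocard_inellipse A C B E"
  using assms unfolding brocard_inellipse_def
  by (metis side_tangent_at_commute symmedian_commute)

text \<open>Exchanging two vertices exchanges \<open>\<alpha>\<close> and \<open>\<beta>\<close>, so one labelling of the triangle satisfies
\<open>\<bar>\<beta>\<bar> < \<bar>\<alpha>\<bar>\<close>. Circumcircle and Brocard inellipse are determined by the triangle, and the image of the
two concentric circles provides both.\<close>

lemma brocard_porism_is_image:
  assumes "brocard_porism P"
  obtains s m n where "0 \<le> s" "s < 1" "m \<noteq> 0"
    "P = (brocard_map s m n ` sphere 0 1, brocard_map s m n ` sphere 0 (1/2))"
proof -
  from assms obtain A0 B0 C0 z R where P0: "triangle {A0, B0, C0}" "0 < R" "fst P = sphere z R"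
    "{A0, B0, C0} \<subseteq> sphere z R" "brocard_inellipse A0 B0 C0 (snd P)"
    unfolding brocard_porism_def by blast
  then have nc0: "\<not> collinear {A0, B0, C0}" by (simp add: triangle_def)
  obtain p \<alpha> \<beta> where f: "A0 = p + \<alpha> + \<beta>" "B0 = p + \<alpha> * \<omega> + \<beta> * \<omega>\<^sup>2" "C0 = p + \<alpha> * \<omega>\<^sup>2 + \<beta> * \<omega>"
    using triangle_fourier .
  have "norm \<alpha> \<noteq> norm \<beta>" using fourier_triangle_collinear[of \<alpha> \<beta> p] nc0 f by auto
  then have "\<exists>B C p \<alpha> \<beta>. A0 = p + \<alpha> + \<beta> \<and> B = p + \<alpha> * \<omega> + \<beta> * \<omega>\<^sup>2 \<and> C = p + \<alpha> * \<omega>\<^sup>2 + \<beta> * \<omega> \<and>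
      norm \<beta> < norm \<alpha> \<and> \<not> collinear {A0, B, C} \<and> {A0, B, C} \<subseteq> sphere z R \<and> brocard_inellipse A0 B C (snd P)"
  proof (cases "norm \<beta> < norm \<alpha>")
    case True
    then show ?thesis using f nc0 P0 by blast
  next
    case False
    then have "norm \<alpha> < norm \<beta>" using \<open>norm \<alpha> \<noteq> norm \<beta>\<close> by simp
    moreover have "A0 = p + \<beta> + \<alpha>" "C0 = p + \<beta> * \<omega> + \<alpha> * \<omega>\<^sup>2" "B0 = p + \<beta> * \<omega>\<^sup>2 + \<alpha> * \<omega>"
      using f by (simp_all add: add.commute add.left_commute)
    moreover have "\<not> collinear {A0, C0, B0}" "{A0, C0, B0} \<subseteq> sphere z R"
      using nc0 P0(4) by (simp_all add: insert_commute)
    ultimately show ?thesis using brocard_inellipse_swap[OF P0(5)] by blast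
  qed
  then obtain B C p \<alpha> \<beta> where g: "A0 = p + \<alpha> + \<beta>" "B = p + \<alpha> * \<omega> + \<beta> * \<omega>\<^sup>2" "C = p + \<alpha> * \<omega>\<^sup>2 + \<beta> * \<omega>"
      "norm \<beta> < norm \<alpha>" and nc: "\<not> collinear {A0, B, C}" and sub: "{A0, B, C} \<subseteq> sphere z R"
      and E: "brocard_inellipse A0 B C (snd P)" by blast
  obtain s m n u where s: "0 \<le> s" "s < 1" "m \<noteq> 0" "norm u = 1"
    and im: "A0 = brocard_map s m n u" "B = brocard_map s m n (u * \<omega>)" "C = brocard_map s m n (u * \<omega>\<^sup>2)"
    using triangle_is_brocard_image[OF g] .
  have s': "\<bar>s\<bar> < 1" using s by simp
  have u: "u \<noteq> 0" using s(4) by auto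
  have w: "u \<in> equilateral u" "u * \<omega> \<in> equilateral u" "u * \<omega>\<^sup>2 \<in> equilateral u"
    "u \<noteq> u * \<omega>" "u * \<omega> \<noteq> u * \<omega>\<^sup>2" "u * \<omega>\<^sup>2 \<noteq> u"
    using u omega_facts(5-7) by (auto simp: equilateral_def)
  have "brocard_inellipse A0 B C (brocard_map s m n ` sphere 0 (1/2))"
    unfolding im by (rule brocard_map_inellipse(2)[OF s' s(3,4) w])
  then have snd: "snd P = brocard_map s m n ` sphere 0 (1/2)"
    using brocard_inellipse_unique[OF nc E] by simp
  have "{A0, B, C} \<subseteq> brocard_map s m n ` sphere 0 1"
    unfolding im using s(4) omega_facts(1) by (auto simp: norm_mult norm_power)
  then have on: "{A0, B, C} \<subseteq> sphere n (norm m)" unfolding brocard_map_circle[OF s' s(3)] .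
  have "fst P = brocard_map s m n ` sphere 0 1"
    unfolding P0(3) brocard_map_circle[OF s' s(3)] circle_through_triangle_unique[OF nc sub on] ..
  then show ?thesis using that[OF s(1-3), of n] snd by (metis prod.collapse)
qed

section \<open>One-parameter families by scaling\<close>

lemma sphere_eq_ellipse:
  assumes "0 < t" shows "sphere 0 t = ellipse 0 0 t t"
  using ellipse_affine_image[of 1 1 t 0 0] assms by (simp add: real_affine_map_def)

lemma real_in_ellipse_iff: "complex_of_real x \<in> ellipse 0 0 a b \<longleftrightarrow> (x / a)\<^sup>2 = 1"
proof
  assume "(x / a)\<^sup>2 = 1"
  then show "complex_of_real x \<in> ellipse 0 0 a b"
    unfolding ellipse_def by (intro CollectI exI[of _ x] exI[of _ 0]) (simp add: complex_eq_iff)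
qed (auto simp: ellipse_def complex_eq_iff)

text \<open>The ratio \<open>r\<close> prescribes \<open>s\<close>; the parameter of the family is the circumradius.\<close>

lemma homothetic_to_brocard_porisms:
  assumes "homothetic_pair H"
  shows "\<exists>I F. one_parameter_family I F \<and> inj_on F I \<and>
    (\<forall>t\<in>I. brocard_porism (F t) \<and> variable_similarity_images (three_periodics H) (three_periodics (F t)))"
proof -
  from assms obtain c \<theta> a b where H: "0 < a" "0 < b" "H = (ellipse c \<theta> a b, ellipse c \<theta> (a / 2) (b / 2))"
    unfolding homothetic_pair_def by blast
  define s where "s = \<bar>a - b\<bar> / (a + b)"
  have s: "0 \<le> s" "s < 1" using H by (simp_all add: s_def)
  then have s': "\<bar>s\<bar> < 1" by simp
  define F where "F t = (brocard_map s (complex_of_real t) 0 ` sphere 0 1, brocard_map s (complex_of_real t) 0 ` sphere 0 (1/2))" for t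
  define I where "I = {0::real<..}"
  have t0: "complex_of_real t \<noteq> 0" if "t \<in> I" for t using that by (simp add: I_def)
  have fst: "fst (F t) = sphere 0 t" if "t \<in> I" for t
    using brocard_map_circle[OF s' t0[OF that], of 0] that by (simp add: F_def I_def)
  have snd: "snd (F t) = ellipse (of_real (t * klein_centre s)) 0 (t * klein_major s) (t * klein_minor s)" if "t \<in> I" for t
    using brocard_map_inner_circle[OF s' t0[OF that], of 0] that by (simp add: F_def I_def Arg_of_real)
  have "continuous_ellipses I (\<lambda>t. fst (F t))"
    unfolding continuous_ellipses_def
    using fst sphere_eq_ellipse
    by (intro exI[of _ "\<lambda>_. 0"] exI[of _ "\<lambda>_. 0"] exI[of _ "\<lambda>t. t"] exI[of _ "\<lambda>t. t"])
      (auto simp: I_def)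
  moreover have "continuous_ellipses I (\<lambda>t. snd (F t))"
    unfolding continuous_ellipses_def
    by (rule exI[of _ "\<lambda>t. of_real (t * klein_centre s)"], rule exI[of _ "\<lambda>_. 0"],
        rule exI[of _ "\<lambda>t. t * klein_major s"], rule exI[of _ "\<lambda>t. t * klein_minor s"])
      (use snd klein_axes_pos[OF s'] in \<open>auto simp: I_def intro!: continuous_intros\<close>)
  ultimately have "one_parameter_family I F"
    unfolding one_parameter_family_def by (auto simp: I_def is_interval_def)
  moreover have "inj_on F I"
  proof (rule inj_onI)
    fix t t' assume t: "t \<in> I" "t' \<in> I" "F t = F t'"
    then have "sphere (0::complex) t = sphere 0 t'" using fst by metis
    moreover have "complex_of_real t \<in> sphere 0 t" using t by (simp add: I_def)
    ultimately have "complex_of_real t \<in> sphere 0 t'" by simp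
    then show "t = t'" using t by (simp add: I_def)
  qed
  moreover have "brocard_porism (F t) \<and> variable_similarity_images (three_periodics H) (three_periodics (F t))"
    if "t \<in> I" for t
    using brocard_map_porism[OF s' t0[OF that]] all_shapes_brocard_map[OF s t0[OF that]]
      all_shapes_homothetic[OF H(1,2), of c \<theta>, folded s_def H(3)]
    unfolding F_def by (auto intro: all_shapes_similarity_images)
  ultimately show ?thesis by blast
qed

text \<open>Semi-axes in the ratio \<open>(1 + s) : (1 - s)\<close> give \<open>\<bar>a - b\<bar> / (a + b) = s\<close>; the parameter is their
common scale.\<close>

lemma brocard_porism_to_homothetic_pairs:
  assumes "brocard_porism B"
  shows "\<exists>I F. one_parameter_family I F \<and> inj_on F I \<and>
    (\<forall>t\<in>I. homothetic_pair (F t) \<and> variable_similarity_images (three_periodics B) (three_periodics (F t)))"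
proof -
  obtain s m n where s: "0 \<le> s" "s < 1" "m \<noteq> 0"
    and B: "B = (brocard_map s m n ` sphere 0 1, brocard_map s m n ` sphere 0 (1/2))"
    using brocard_porism_is_image[OF assms] .
  define F where "F t = (ellipse 0 0 (t * (1 + s)) (t * (1 - s)), ellipse 0 0 (t * (1 + s) / 2) (t * (1 - s) / 2))" for t
  define I where "I = {0::real<..}"
  have pos: "0 < t * (1 + s)" "0 < t * (1 - s)" if "t \<in> I" for t using that s by (simp_all add: I_def)
  have "continuous_ellipses I (\<lambda>t. fst (F t))"
    unfolding continuous_ellipses_def
    by (rule exI[of _ "\<lambda>_. 0"], rule exI[of _ "\<lambda>_. 0"], rule exI[of _ "\<lambda>t. t * (1 + s)"],
        rule exI[of _ "\<lambda>t. t * (1 - s)"]) (use pos in \<open>auto simp: F_def intro!: continuous_intros\<close>)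
  moreover have "continuous_ellipses I (\<lambda>t. snd (F t))"
    unfolding continuous_ellipses_def
    by (rule exI[of _ "\<lambda>_. 0"], rule exI[of _ "\<lambda>_. 0"], rule exI[of _ "\<lambda>t. t * (1 + s) / 2"],
        rule exI[of _ "\<lambda>t. t * (1 - s) / 2"]) (use pos in \<open>auto simp: F_def intro!: continuous_intros\<close>)
  ultimately have "one_parameter_family I F"
    unfolding one_parameter_family_def by (auto simp: I_def is_interval_def)
  moreover have "inj_on F I"
  proof (rule inj_onI)
    fix t t' assume t: "t \<in> I" "t' \<in> I" "F t = F t'"
    have "complex_of_real (t * (1 + s)) \<in> fst (F t)"
      using pos(1)[OF t(1)] unfolding F_def fst_conv real_in_ellipse_iff by (subst divide_self) auto
    then have "complex_of_real (t * (1 + s)) \<in> fst (F t')" using t(3) by simp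
    then have "(t * (1 + s) / (t' * (1 + s)))\<^sup>2 = 1"
      unfolding F_def fst_conv real_in_ellipse_iff .
    then have "(t / t')\<^sup>2 = 1" using s by simp
    then show "t = t'" using t(1,2) by (auto simp: power2_eq_1_iff I_def field_simps)
  qed
  moreover have "homothetic_pair (F t) \<and> variable_similarity_images (three_periodics B) (three_periodics (F t))"
    if t: "t \<in> I" for t
  proof -
    have "t * (1 + s) - t * (1 - s) = 2 * t * s" "t * (1 + s) + t * (1 - s) = 2 * t" by (simp_all add: algebra_simps)
    then have "\<bar>t * (1 + s) - t * (1 - s)\<bar> / (t * (1 + s) + t * (1 - s)) = s"
      using t s by (simp add: I_def)
    then have "all_shapes s (three_periodics (F t))"
      using all_shapes_homothetic[OF pos[OF t], of 0 0] by (simp add: F_def)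
    then show ?thesis
      using all_shapes_brocard_map[OF s, of n] pos[OF t] unfolding B F_def homothetic_pair_def
      by (auto intro: all_shapes_similarity_images)
  qed
  ultimately show ?thesis by blast
qed

theorem theorem3:
  shows "(\<forall>H. homothetic_pair H \<longrightarrow>
           (\<exists>I F. one_parameter_family I F \<and> inj_on F I \<and>
              (\<forall>t\<in>I. brocard_porism (F t) \<and>
                 variable_similarity_images (three_periodics H) (three_periodics (F t))))) \<and>
         (\<forall>B. brocard_porism B \<longrightarrow>
           (\<exists>I F. one_parameter_family I F \<and> inj_on F I \<and>
              (\<forall>t\<in>I. homothetic_pair (F t) \<and>
                 variable_similarity_images (three_periodics B) (three_periodics (F t)))))"
  using homothetic_to_brocard_porisms brocard_porism_to_homothetic_pairs by blast

end
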